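(* Consider the finite-dimensional model $\hat y_k=\eta T_s s_k+\eta T_g\,\mathbf g_2[k]+n_k$ and the asymptotic model $\bar y_k=\eta\overline T_s s_k+\eta\overline T_g\,\mathbf g_2[k]+n_k$ ($k\in[K]$) described in the context, under all the assumptions listed there. Let $\beta\in\mathbb C\setminus\{0\}$, and put $$\widehat{\mathrm{SEP}}_k(\beta)=\mathbb P\big(\mathrm{dec}(\beta\hat y_k)\ne s_k\big),\qquad \overline{\mathrm{SEP}}(\beta)=\mathbb P\big(\mathrm{dec}(\beta\bar y_k)\ne s_k\big)$$ (the latter does not depend on $k$). For $m=1,\dots,M$ let $$L_m=\left(\frac{\sqrt\pi}{|\beta\eta\overline T_g|^2+|\beta|^2\sigma^2}+1\right)\max\Big\{|\beta|\eta|s^{(m)}|+1,\ |\beta|\eta+1\Big\}.$$ Then there exists $\bar K>0$ such that for all $K>\bar K$ and all $k\in[K]$, $$\big|\widehat{\mathrm{SEP}}_k(\beta)-\overline{\mathrm{SEP}}(\beta)\big|\le\frac1M\sum_{m=1}^M L_m\Big(\mathsf d_{KF}(T_s,\overline T_s)+\mathsf d_{KF}\big(T_g\,\mathbf g_2[k],\overline T_g\,\mathbf g_2[k]\big)\Big).$$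
   Context: Notation: $[K]=\{1,\dots,K\}$; $\dagger$ is complex conjugation, ${}^{\mathsf H}$ conjugate transpose; $x[i]$ is the $i$-th entry and $x[i:j]$ the subvector of entries $i,\dots,j$; $\|\cdot\|$ is the Euclidean norm; $\mathcal{CN}(0,v)$ is the circularly symmetric complex Gaussian law with $\mathbb E|Z|^2=v$. The Ky Fan distance is $\mathsf d_{KF}(X,Y)=\inf\{\delta>0:\mathbb P(|X-Y|>\delta)<\delta\}$. $\mathrm{dec}(\cdot)$ maps its argument to the nearest point of $\mathcal S_M$. Assumptions. For each $K$ there is $N=N(K)$ ($N,K\ge3$), with $N/K\to\gamma\in(1,\infty)$ as $K\to\infty$. The channel $\mathbf H\in\mathbb C^{K\times N}$ has i.i.d. $\mathcal{CN}(0,1/N)$ entries; $\mathbf D$ is the $K\times N$ (rectangular diagonal) matrix of singular values $d_1,\dots,d_K$ of $\mathbf H$. The noise $\mathbf n$ has i.i.d. $\mathcal{CN}(0,\sigma^2)$ entries $n_k$. The vector $\mathbf s\in\mathbb C^K$ has i.i.d. entries $s_k$ uniform on a finite set $\mathcal S_M=\{s^{(1)},\dots,s^{(M)}\}\subset\mathbb C\setminus\{0\}$, and $\sigma_s^2=\mathbb E|s_1|^2$. $\mathbf g_1,\mathbf g_2\sim\mathcal{CN}(0,I_K)$, $\mathbf z_1,\mathbf z_2\sim\mathcal{CN}(0,I_N)$; $\mathbf D,\mathbf s,\mathbf n,\mathbf g_1,\mathbf g_2,\mathbf z_1,\mathbf z_2$ are mutually independent. The function $f$ on $(0,\infty)$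 is positive, continuous a.e., and bounded on compact subsets of $(0,\infty)$; $f(\mathbf D)=(\mathrm{diag}(f(d_1),\dots,f(d_K))\ \ 0_{K\times(N-K)})$. The quantizer $q:\mathbb C\to\mathcal X_{\mathcal L}$ (a finite subset of $\mathbb C$), applied entrywise to vectors, is continuous a.e., satisfies $|q|\le M_0$ for some $M_0>0$, and its discontinuity set is a union of finitely many lines and rays. $\eta>0$ is fixed. Finite model. For nonzero $v\in\mathbb C^n$, $\mathbf R(v)$ is the $n\times n$ unitary Householder transformation matrix associated with $v$, $\mathbf R(v)=(v/\|v\|,\ \mathbf B(v))$, where the $n-1$ columns of $\mathbf B(v)$ form an orthonormal basis of the orthogonal complement of $v$. Put $$\hat{\mathbf s}_1=\tfrac{\|\mathbf s\|}{\|\mathbf g_1\|}f(\mathbf D)^{T}\mathbf g_1,\quad C_1=\frac{\mathbf z_1^{\mathsf H}q\big(\frac{\|\hat{\mathbf s}_1\|}{\|\mathbf z_1\|}\mathbf z_1\big)}{\|\hat{\mathbf s}_1\|\|\mathbf z_1\|},\quad C_2=\frac{\big\|\mathbf B(\mathbf z_1)^{\mathsf H}q\big(\frac{\|\hat{\mathbf s}_1\|}{\|\mathbf z_1\|}\mathbf z_1\big)\big\|}{\|\mathbf z_2[2:N]\|},$$ $$W=C_1\mathbf D\hat{\mathbf s}_1+C_2\mathbf D\mathbf B(\hat{\mathbf s}_1)\mathbf z_2[2:N],\quad T_g=\frac{\|\mathbf B(\mathbf g_1)^{\mathsf H}W\|}{\|(\mathbf R(\mathbf s)^{-1}\mathbf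 g_2)[2:K]\|},\quad T_s=\frac{\mathbf g_1^{\mathsf H}W}{\|\mathbf g_1\|\|\mathbf s\|}-T_g\frac{(\mathbf R(\mathbf s)^{-1}\mathbf g_2)[1]}{\|\mathbf s\|}.$$ Asymptotic model. $Z\sim\mathcal{CN}(0,1)$; $d=\sqrt\lambda$ where $\lambda$ has the Marchenko–Pastur density $p_\lambda(x)=\frac{\sqrt{(x-a)_+(b-x)_+}}{2\pi cx}$, $c=1/\gamma$, $a=(1-\sqrt c)^2$, $b=(1+\sqrt c)^2$; $$\alpha=\sqrt{\sigma_s^2\mathbb E[f^2(d)]/\gamma},\quad \overline C_1=\frac{\mathbb E[Z^\dagger q(\alpha Z)]}{\alpha},\quad \overline C_2=\sqrt{\mathbb E|q(\alpha Z)|^2-|\mathbb E[Z^\dagger q(\alpha Z)]|^2},$$ $$\overline T_s=\overline C_1\mathbb E[df(d)],\qquad \overline T_g=\sqrt{\sigma_s^2|\overline C_1|^2\,\mathrm{var}[df(d)]+\overline C_2^2}.$$ *)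

theory Defs
  imports
    "HOL-Probability.Probability"
    "Jordan_Normal_Form.Schur_Decomposition"
begin

(* Jordan_Normal_Form and HOL-Analysis share the names vec, mat and the symbols for entries
   and inner products. *)
hide_const (open) Finite_Cartesian_Product.vec Cartesian_Space.vector Determinants.det
hide_type (open) Finite_Cartesian_Product.vec
unbundle no vec_syntax
unbundle no inner_syntax

text \<open>Scaling the standard law makes \<open>CN 0\<close> the point mass at 0.\<close>

definition CN1 :: "complex measure" where
  "CN1 = density lborel (\<lambda>z. ennreal (exp (- (cmod z)\<^sup>2) / pi))"

definition CN :: "real \<Rightarrow> complex measure" where
  "CN v = distr CN1 borel (\<lambda>z. complex_of_real (sqrt v) * z)"

definition uniform_on :: "complex set \<Rightarrow> complex measure" where
  "uniform_on S = distr (measure_pmf (pmf_of_set S)) borel (\<lambda>z. z)"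

definition iid :: "'w measure \<Rightarrow> complex measure \<Rightarrow> ('i \<Rightarrow> 'w \<Rightarrow> complex) \<Rightarrow> 'i set \<Rightarrow> bool" where
  "iid P \<mu> X I \<longleftrightarrow>
     prob_space.indep_vars P (\<lambda>_. borel) X I \<and> (\<forall>i\<in>I. distr P borel (X i) = \<mu>)"

text \<open>A pair \<open>(n, X)\<close> stands for the random vector with entries \<open>X 0, \<dots>, X (n - 1)\<close>. The vectors are
  indexed by their position in the list, so that repeated entries are not identified.\<close>

definition indep_vectors :: "'w measure \<Rightarrow> (nat \<times> (nat \<Rightarrow> 'w \<Rightarrow> complex)) list \<Rightarrow> bool" where
  "indep_vectors P Xs \<longleftrightarrow>
     prob_space.indep_vars P
       (\<lambda>b. Pi\<^sub>M {..<fst (Xs ! b)} (\<lambda>_. borel))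
       (\<lambda>b \<omega>. \<lambda>i\<in>{..<fst (Xs ! b)}. snd (Xs ! b) i \<omega>)
       {..<length Xs}"

definition dKF :: "'w measure \<Rightarrow> ('w \<Rightarrow> complex) \<Rightarrow> ('w \<Rightarrow> complex) \<Rightarrow> real" where
  "dKF P X Y = Inf {\<delta>. \<delta> > 0 \<and> measure P {\<omega> \<in> space P. cmod (X \<omega> - Y \<omega>) > \<delta>} < \<delta>}"

text \<open>Indices start at 0: the entry \<open>x[1]\<close> of the mathematical notation is \<open>x $ 0\<close>, and
  \<open>x[2:n]\<close> is \<open>vtail x\<close>. The product \<open>w \<bullet>c v\<close> conjugates its second argument, so it is \<open>v\<close>
  conjugate-transposed times \<open>w\<close>.\<close>

definition vnorm :: "complex vec \<Rightarrow> real" where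
  "vnorm v = sqrt (\<Sum>i<dim_vec v. (cmod (v $ i))\<^sup>2)"

definition vtail :: "complex vec \<Rightarrow> complex vec" where
  "vtail v = vec (dim_vec v - 1) (\<lambda>i. v $ Suc i)"

definition tail_cols :: "complex mat \<Rightarrow> complex mat" where
  "tail_cols A = mat (dim_row A) (dim_col A - 1) (\<lambda>(i, j). A $$ (i, Suc j))"

definition unitary :: "nat \<Rightarrow> complex mat \<Rightarrow> bool" where
  "unitary n U \<longleftrightarrow> U \<in> carrier_mat n n \<and> mat_adjoint U * U = 1\<^sub>m n"

definition rect_diag :: "nat \<Rightarrow> nat \<Rightarrow> (nat \<Rightarrow> real) \<Rightarrow> complex mat" where
  "rect_diag m n x = mat m n (\<lambda>(i, j). if i = j then complex_of_real (x i) else 0)"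

text \<open>\<open>x\<close> lists the singular values of \<open>A\<close>, in any order: they are the diagonal of the middle factor
  of a singular value decomposition of \<open>A\<close>.\<close>

definition singular_values :: "complex mat \<Rightarrow> (nat \<Rightarrow> real) \<Rightarrow> bool" where
  "singular_values A x \<longleftrightarrow>
     (\<forall>i < min (dim_row A) (dim_col A). 0 \<le> x i) \<and>
     (\<exists>U V. unitary (dim_row A) U \<and> unitary (dim_col A) V \<and>
        A = U * rect_diag (dim_row A) (dim_col A) x * mat_adjoint V)"

text \<open>A choice of the matrices \<open>R(v) = (v/\<parallel>v\<parallel>, B(v))\<close>. By unitarity the columns of \<open>B(v)\<close> are an
  orthonormal basis of the complement of \<open>v\<close>; phase and sign conventions for complex Householder
  matrices differ, and no particular one is imposed. The dependence on \<open>v\<close> has to be measurable for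
  the quantities below to be random variables. The value at 0 plays no role.\<close>

definition householder :: "(complex vec \<Rightarrow> complex mat) \<Rightarrow> bool" where
  "householder R \<longleftrightarrow>
     (\<forall>n. \<forall>v \<in> carrier_vec n. unitary n (R v) \<and>
        (v \<noteq> 0\<^sub>v n \<longrightarrow> col (R v) 0 = complex_of_real (1 / vnorm v) \<cdot>\<^sub>v v)) \<and>
     (\<forall>n. \<forall>i<n. \<forall>j<n.
        (\<lambda>x. R (vec n x) $$ (i, j)) \<in> borel_measurable (Pi\<^sub>M {..<n} (\<lambda>_. borel)))"

abbreviation hB :: "(complex vec \<Rightarrow> complex mat) \<Rightarrow> complex vec \<Rightarrow> complex mat" where
  "hB R v \<equiv> tail_cols (R v)"

definition is_line :: "complex set \<Rightarrow> bool" where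
  "is_line A \<longleftrightarrow> (\<exists>a u. u \<noteq> 0 \<and> A = {a + complex_of_real t * u | t. True})"

definition is_ray :: "complex set \<Rightarrow> bool" where
  "is_ray A \<longleftrightarrow> (\<exists>a u. u \<noteq> 0 \<and> A = {a + complex_of_real t * u | t. t \<ge> 0})"

text \<open>Borel measurability does not follow from continuity almost everywhere, but is needed for the
  model quantities to be random variables. The values of \<open>f\<close> outside the positive reals play no
  role.\<close>

definition admissible_f :: "(real \<Rightarrow> real) \<Rightarrow> bool" where
  "admissible_f f \<longleftrightarrow>
     f \<in> borel_measurable borel \<and>
     (\<forall>x>0. f x > 0) \<and>
     (AE x in lborel. x > 0 \<longrightarrow> isCont f x) \<and>
     (\<forall>C. compact C \<and> C \<subseteq> {0<..} \<longrightarrow> bounded (f ` C))"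

definition admissible_q :: "(complex \<Rightarrow> complex) \<Rightarrow> complex set \<Rightarrow> real \<Rightarrow> bool" where
  "admissible_q q X M0 \<longleftrightarrow>
     q \<in> borel_measurable borel \<and>
     finite X \<and> range q \<subseteq> X \<and>
     (AE z in lborel. isCont q z) \<and>
     M0 > 0 \<and> (\<forall>z. cmod (q z) \<le> M0) \<and>
     (\<exists>\<A>. finite \<A> \<and> (\<forall>A\<in>\<A>. is_line A \<or> is_ray A) \<and> {z. \<not> isCont q z} = \<Union>\<A>)"

text \<open>Any measurable rule for breaking ties is allowed.\<close>

definition nearest_point_map :: "complex set \<Rightarrow> (complex \<Rightarrow> complex) \<Rightarrow> bool" where
  "nearest_point_map S dec \<longleftrightarrow>
     dec \<in> borel_measurable borel \<and>
     (\<forall>y. dec y \<in> S \<and> (\<forall>z\<in>S. dist y (dec y) \<le> dist y z))"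

text \<open>The arguments \<open>D\<close> and \<open>fD\<close> are the matrices \<open>D\<close> and \<open>f(D)\<close>.\<close>

definition s1_hat :: "complex mat \<Rightarrow> complex vec \<Rightarrow> complex vec \<Rightarrow> complex vec" where
  "s1_hat fD s g1 =
     complex_of_real (vnorm s / vnorm g1) \<cdot>\<^sub>v (transpose_mat fD *\<^sub>v g1)"

definition quantized :: "(complex \<Rightarrow> complex) \<Rightarrow> complex vec \<Rightarrow> complex vec \<Rightarrow> complex vec" where
  "quantized q sh z1 = map_vec q (complex_of_real (vnorm sh / vnorm z1) \<cdot>\<^sub>v z1)"

definition C1_hat :: "(complex \<Rightarrow> complex) \<Rightarrow> complex vec \<Rightarrow> complex vec \<Rightarrow> complex" where
  "C1_hat q sh z1 = (quantized q sh z1 \<bullet>c z1) / complex_of_real (vnorm sh * vnorm z1)"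

definition C2_hat :: "(complex vec \<Rightarrow> complex mat) \<Rightarrow> (complex \<Rightarrow> complex) \<Rightarrow>
    complex vec \<Rightarrow> complex vec \<Rightarrow> complex vec \<Rightarrow> real" where
  "C2_hat R q sh z1 z2 =
     vnorm (mat_adjoint (hB R z1) *\<^sub>v quantized q sh z1) / vnorm (vtail z2)"

definition W_hat :: "(complex vec \<Rightarrow> complex mat) \<Rightarrow> (complex \<Rightarrow> complex) \<Rightarrow> complex mat \<Rightarrow> complex mat \<Rightarrow>
    complex vec \<Rightarrow> complex vec \<Rightarrow> complex vec \<Rightarrow> complex vec \<Rightarrow> complex vec" where
  "W_hat R q D fD s g1 z1 z2 =
     (let sh = s1_hat fD s g1 in
        C1_hat q sh z1 \<cdot>\<^sub>v (D *\<^sub>v sh)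
        + complex_of_real (C2_hat R q sh z1 z2) \<cdot>\<^sub>v (D *\<^sub>v (hB R sh *\<^sub>v vtail z2)))"

definition rotated :: "(complex vec \<Rightarrow> complex mat) \<Rightarrow> complex vec \<Rightarrow> complex vec \<Rightarrow> complex vec" where
  "rotated R s g2 = the (mat_inverse (R s)) *\<^sub>v g2"

definition T_g :: "(complex vec \<Rightarrow> complex mat) \<Rightarrow> (complex \<Rightarrow> complex) \<Rightarrow> complex mat \<Rightarrow> complex mat \<Rightarrow>
    complex vec \<Rightarrow> complex vec \<Rightarrow> complex vec \<Rightarrow> complex vec \<Rightarrow> complex vec \<Rightarrow> real" where
  "T_g R q D fD s g1 g2 z1 z2 =
     vnorm (mat_adjoint (hB R g1) *\<^sub>v W_hat R q D fD s g1 z1 z2) / vnorm (vtail (rotated R s g2))"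

definition T_s :: "(complex vec \<Rightarrow> complex mat) \<Rightarrow> (complex \<Rightarrow> complex) \<Rightarrow> complex mat \<Rightarrow> complex mat \<Rightarrow>
    complex vec \<Rightarrow> complex vec \<Rightarrow> complex vec \<Rightarrow> complex vec \<Rightarrow> complex vec \<Rightarrow> complex" where
  "T_s R q D fD s g1 g2 z1 z2 =
     (W_hat R q D fD s g1 z1 z2 \<bullet>c g1) / complex_of_real (vnorm g1 * vnorm s)
     - complex_of_real (T_g R q D fD s g1 g2 z1 z2) * (rotated R s g2 $ 0) / complex_of_real (vnorm s)"

definition mp_density :: "real \<Rightarrow> real \<Rightarrow> real" where
  "mp_density \<gamma> x =
     (let c = 1 / \<gamma>; a = (1 - sqrt c)\<^sup>2; b = (1 + sqrt c)\<^sup>2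
      in sqrt (max 0 (x - a) * max 0 (b - x)) / (2 * pi * c * x))"

definition d_law :: "real \<Rightarrow> real measure" where
  "d_law \<gamma> = distr (density lborel (\<lambda>x. ennreal (mp_density \<gamma> x))) borel sqrt"

definition sigma_s2 :: "complex set \<Rightarrow> real" where
  "sigma_s2 S = measure_pmf.expectation (pmf_of_set S) (\<lambda>z. (cmod z)\<^sup>2)"

definition alpha_bar :: "real \<Rightarrow> complex set \<Rightarrow> (real \<Rightarrow> real) \<Rightarrow> real" where
  "alpha_bar \<gamma> S f = sqrt (sigma_s2 S * (\<integral>x. (f x)\<^sup>2 \<partial>d_law \<gamma>) / \<gamma>)"

definition zq_corr :: "(complex \<Rightarrow> complex) \<Rightarrow> real \<Rightarrow> complex" where
  "zq_corr q a = (\<integral>z. cnj z * q (complex_of_real a * z) \<partial>CN 1)"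

definition C1_bar :: "real \<Rightarrow> complex set \<Rightarrow> (real \<Rightarrow> real) \<Rightarrow> (complex \<Rightarrow> complex) \<Rightarrow> complex" where
  "C1_bar \<gamma> S f q = zq_corr q (alpha_bar \<gamma> S f) / complex_of_real (alpha_bar \<gamma> S f)"

definition C2_bar :: "real \<Rightarrow> complex set \<Rightarrow> (real \<Rightarrow> real) \<Rightarrow> (complex \<Rightarrow> complex) \<Rightarrow> real" where
  "C2_bar \<gamma> S f q =
     sqrt ((\<integral>z. (cmod (q (complex_of_real (alpha_bar \<gamma> S f) * z)))\<^sup>2 \<partial>CN 1)
           - (cmod (zq_corr q (alpha_bar \<gamma> S f)))\<^sup>2)"

definition mean_df :: "real \<Rightarrow> (real \<Rightarrow> real) \<Rightarrow> real" where
  "mean_df \<gamma> f = (\<integral>x. x * f x \<partial>d_law \<gamma>)"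

definition var_df :: "real \<Rightarrow> (real \<Rightarrow> real) \<Rightarrow> real" where
  "var_df \<gamma> f = (\<integral>x. (x * f x - mean_df \<gamma> f)\<^sup>2 \<partial>d_law \<gamma>)"

definition T_s_bar :: "real \<Rightarrow> complex set \<Rightarrow> (real \<Rightarrow> real) \<Rightarrow> (complex \<Rightarrow> complex) \<Rightarrow> complex" where
  "T_s_bar \<gamma> S f q = C1_bar \<gamma> S f q * complex_of_real (mean_df \<gamma> f)"

definition T_g_bar :: "real \<Rightarrow> complex set \<Rightarrow> (real \<Rightarrow> real) \<Rightarrow> (complex \<Rightarrow> complex) \<Rightarrow> real" where
  "T_g_bar \<gamma> S f q =
     sqrt (sigma_s2 S * (cmod (C1_bar \<gamma> S f q))\<^sup>2 * var_df \<gamma> f + (C2_bar \<gamma> S f q)\<^sup>2)"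

definition SEP :: "'w measure \<Rightarrow> (complex \<Rightarrow> complex) \<Rightarrow> complex \<Rightarrow>
    ('w \<Rightarrow> complex) \<Rightarrow> ('w \<Rightarrow> complex) \<Rightarrow> real" where
  "SEP P dec \<beta> y s = measure P {\<omega> \<in> space P. dec (\<beta> * y \<omega>) \<noteq> s \<omega>}"

definition eff_var :: "complex \<Rightarrow> real \<Rightarrow> real \<Rightarrow> real \<Rightarrow> real" where
  "eff_var \<beta> \<eta> \<sigma> Tg = (cmod (\<beta> * complex_of_real (\<eta> * Tg)))\<^sup>2 + (cmod \<beta>)\<^sup>2 * \<sigma>\<^sup>2"

definition L_const :: "complex \<Rightarrow> real \<Rightarrow> real \<Rightarrow> real \<Rightarrow> complex \<Rightarrow> real" where
  "L_const \<beta> \<eta> \<sigma> Tg z =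
     (sqrt pi / eff_var \<beta> \<eta> \<sigma> Tg + 1) * max (cmod \<beta> * \<eta> * cmod z + 1) (cmod \<beta> * \<eta> + 1)"

end

theory Submission
  imports Defs
begin

text \<open>
  Off an event of probability at most \<open>\<delta>\<^sub>1 + \<delta>\<^sub>2\<close>, with \<open>\<delta>\<^sub>1\<close>, \<open>\<delta>\<^sub>2\<close> slightly larger than the two Ky Fan
  distances, the two observations differ by at most \<open>\<eta> (\<bar>s\<^sub>k\<bar> \<delta>\<^sub>1 + \<delta>\<^sub>2)\<close>. If exactly one of them is then
  decoded correctly, the Gaussian part of the asymptotic observation lies in a shell of this width
  along the boundary of the Voronoi cell of \<open>s\<^sub>k\<close>. Only the Gaussian part and its independence of
  \<open>s\<^sub>k\<close> matter, so no asymptotics in \<open>K\<close> enter.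

  The shell of width \<open>e\<close> along the boundary of a convex polygon has measure at most
  \<open>4 e / sqrt (pi v)\<close> under \<open>CN v\<close>, whatever the number of sides: on a line parallel to a coordinate
  axis the convex piecewise linear function defining the polygon crosses the shell at most twice, so
  the time spent there, weighted by the slope, is at most \<open>2 e\<close>.

  Non-measurable sets have measure 0 in the library, so the Ky Fan distances are meaningful only after
  \<open>T\<^sub>s\<close> and \<open>T\<^sub>g\<close> have been shown to be measurable.
\<close>

section \<open>The complex Gaussian law\<close>

lemma measurable_Complex [measurable (raw)]:
  assumes "f \<in> borel_measurable M" "g \<in> borel_measurable M"
  shows "(\<lambda>x. Complex (f x) (g x)) \<in> borel_measurable M"
  using assms by (simp add: borel_measurable_complex_iff)

text \<open>Both measures give an open box the product of its side lengths. Planar integrals thereby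
  become iterated real integrals, in either order.\<close>

lemma lborel_complex:
  "(lborel :: complex measure) = distr (lborel \<Otimes>\<^sub>M lborel) borel (\<lambda>(x, y). Complex x y)"
proof (rule lborel_eqI)
  fix l u :: complex
  assume "\<And>b. b \<in> Basis \<Longrightarrow> inner l b \<le> inner u b"
  then have le: "Re l \<le> Re u" "Im l \<le> Im u"
    by (auto dest: spec[of _ 1] simp: inner_complex_def dest: meta_spec[of _ 1] meta_spec[of _ \<i>])
  have "(\<lambda>(x, y). Complex x y) -` box l u \<inter> space (lborel \<Otimes>\<^sub>M lborel)
      = {Re l<..<Re u} \<times> {Im l<..<Im u}"
    by (auto simp: box_complex_eq space_pair_measure)
  then show "emeasure (distr (lborel \<Otimes>\<^sub>M lborel) borel (\<lambda>(x, y). Complex x y)) (box l u)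
      = (\<Prod>b\<in>Basis. inner (u - l) b)"
    using le by (subst emeasure_distr)
      (auto simp: lborel.emeasure_pair_measure_Times Basis_complex_def ennreal_mult)
qed simp

lemma nn_integral_lborel_complex:
  assumes [measurable]: "f \<in> borel_measurable borel"
  shows "(\<integral>\<^sup>+z. f z \<partial>lborel) = (\<integral>\<^sup>+y. \<integral>\<^sup>+x. f (Complex x y) \<partial>lborel \<partial>lborel)"
    and "(\<integral>\<^sup>+z. f z \<partial>lborel) = (\<integral>\<^sup>+x. \<integral>\<^sup>+y. f (Complex x y) \<partial>lborel \<partial>lborel)"
proof -
  have *: "(\<integral>\<^sup>+z. f z \<partial>lborel) = (\<integral>\<^sup>+p. f (Complex (fst p) (snd p)) \<partial>(lborel \<Otimes>\<^sub>M lborel))"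
    by (subst lborel_complex) (simp add: nn_integral_distr case_prod_beta)
  show "(\<integral>\<^sup>+z. f z \<partial>lborel) = (\<integral>\<^sup>+y. \<integral>\<^sup>+x. f (Complex x y) \<partial>lborel \<partial>lborel)"
    unfolding * by (subst lborel_pair.nn_integral_snd[symmetric]) auto
  show "(\<integral>\<^sup>+z. f z \<partial>lborel) = (\<integral>\<^sup>+x. \<integral>\<^sup>+y. f (Complex x y) \<partial>lborel \<partial>lborel)"
    unfolding * by (subst lborel.nn_integral_fst[symmetric]) auto
qed

lemma nn_integral_lborel_affine:
  fixes f :: "complex \<Rightarrow> ennreal"
  assumes [measurable]: "f \<in> borel_measurable borel" and "c \<noteq> 0"
  shows "(\<integral>\<^sup>+z. f z \<partial>lborel) = ennreal (c\<^sup>2) * (\<integral>\<^sup>+z. f (t + of_real c * z) \<partial>lborel)"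
  by (subst lborel_affine[OF \<open>c \<noteq> 0\<close>, of t])
    (simp add: nn_integral_density nn_integral_distr nn_integral_cmult scaleR_conv_of_real)

text \<open>The law of a single real coordinate: the centred normal density of variance
  \<open>v / 2\<close>.\<close>

definition cn_marginal_density :: "real \<Rightarrow> real \<Rightarrow> real" where
  "cn_marginal_density v x = exp (- x\<^sup>2 / v) / sqrt (pi * v)"

definition cn_density :: "real \<Rightarrow> complex \<Rightarrow> real" where
  "cn_density v z = exp (- (cmod z)\<^sup>2 / v) / (pi * v)"

lemma cn_marginal_density_nonneg: "0 < v \<Longrightarrow> 0 \<le> cn_marginal_density v x"
  by (simp add: cn_marginal_density_def)

lemma cn_marginal_density_le: "0 < v \<Longrightarrow> cn_marginal_density v x \<le> 1 / sqrt (pi * v)"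
  by (simp add: cn_marginal_density_def divide_right_mono)

lemma measurable_cn_marginal_density [measurable]: "cn_marginal_density v \<in> borel_measurable borel"
  unfolding cn_marginal_density_def by measurable

lemma cn_density_nonneg: "0 < v \<Longrightarrow> 0 \<le> cn_density v z"
  by (simp add: cn_density_def)

lemma measurable_cn_density [measurable]: "cn_density v \<in> borel_measurable borel"
  unfolding cn_density_def by measurable

lemma cn_density_Complex:
  assumes "0 < v"
  shows "cn_density v (Complex x y) = cn_marginal_density v x * cn_marginal_density v y"
proof -
  have "- (x\<^sup>2 + y\<^sup>2) / v = - x\<^sup>2 / v + - y\<^sup>2 / v"
    by (simp add: diff_divide_distrib)
  then show ?thesis
    unfolding cn_density_def cn_marginal_density_def cmod_power2 complex.sel
    by (simp only: exp_add) (use assms in simp)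
qed

lemma nn_integral_cn_marginal_density:
  assumes "0 < v"
  shows "(\<integral>\<^sup>+x. ennreal (cn_marginal_density v x) \<partial>lborel) = 1"
proof -
  have "cn_marginal_density v = normal_density 0 (sqrt (v / 2))"
    using assms by (auto simp: cn_marginal_density_def normal_density_def fun_eq_iff mult_ac)
  then show ?thesis
    using assms integral_normal_density[of "sqrt (v / 2)" 0] integrable_normal_density[of "sqrt (v / 2)" 0]
    by (subst nn_integral_eq_integral) auto
qed

lemma nn_integral_cn_density:
  assumes "0 < v"
  shows "(\<integral>\<^sup>+z. ennreal (cn_density v z) \<partial>lborel) = 1"
  using assms
  by (simp add: nn_integral_lborel_complex(1) cn_density_Complex ennreal_mult cn_marginal_density_nonneg
      nn_integral_cmult nn_integral_multc nn_integral_cn_marginal_density)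

lemma CN1_eq: "CN1 = density lborel (\<lambda>z. ennreal (cn_density 1 z))"
  by (simp add: CN1_def cn_density_def)

lemma prob_space_CN1: "prob_space CN1"
  by (rule prob_spaceI) (simp add: CN1_eq emeasure_density nn_integral_cn_density)

lemma sets_CN1 [measurable_cong, simp]: "sets CN1 = sets borel"
  by (simp add: CN1_def)

section \<open>Linear combinations of independent complex Gaussians\<close>

text \<open>Completing the square in \<open>y\<close>.\<close>

lemma cn_density_convolve:
  fixes a b :: real
  assumes "a \<noteq> 0"
  defines "v \<equiv> a\<^sup>2 + b\<^sup>2"
  shows "cn_density 1 (of_real (- b / a) * y + of_real (1 / a) * w) * cn_density 1 y / a\<^sup>2
    = cn_density v w * cn_density (a\<^sup>2 / v) (y - of_real (b / v) * w)"
proof -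
  have v: "0 < v"
    using assms by (simp add: v_def sum_power2_gt_zero_iff)
  \<comment> \<open>In probabilistic terms \<open>b / v * w\<close> and \<open>a\<^sup>2 / v\<close>
    are the conditional mean and variance of \<open>y\<close> given \<open>w = a x + b y\<close>.
    The real identity is used once for each coordinate.\<close>
  have *: "(- b / a * p + 1 / a * q)\<^sup>2 + p\<^sup>2 = q\<^sup>2 / v + (p - b / v * q)\<^sup>2 / (a\<^sup>2 / v)" for p q :: real
  proof -
    have "q\<^sup>2 / v + (p - b / v * q)\<^sup>2 / (a\<^sup>2 / v) = (a\<^sup>2 * q\<^sup>2 + (p * v - b * q)\<^sup>2) / (a\<^sup>2 * v)"
    proof -
      have "p - b / v * q = (p * v - b * q) / v"
        using v by (simp add: field_simps)
      then show ?thesis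
        using v assms by (simp add: power_divide add_divide_distrib power2_eq_square)
    qed
    also have "a\<^sup>2 * q\<^sup>2 + (p * v - b * q)\<^sup>2 = ((q - b * p)\<^sup>2 + a\<^sup>2 * p\<^sup>2) * v"
      unfolding v_def by (simp add: power2_eq_square algebra_simps)
    also have "\<dots> / (a\<^sup>2 * v) = (q - b * p)\<^sup>2 / a\<^sup>2 + p\<^sup>2"
      using v assms by (simp add: add_divide_distrib)
    also have "(q - b * p)\<^sup>2 / a\<^sup>2 = (- b / a * p + 1 / a * q)\<^sup>2"
      by (simp add: power_divide diff_divide_distrib flip: power_divide)
    finally show ?thesis
      by simp
  qed
  have "(cmod (of_real (- b / a) * y + of_real (1 / a) * w))\<^sup>2 + (cmod y)\<^sup>2
      = (cmod w)\<^sup>2 / v + (cmod (y - of_real (b / v) * w))\<^sup>2 / (a\<^sup>2 / v)"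
    using *[of "Re y" "Re w"] *[of "Im y" "Im w"]
    unfolding cmod_power2 add_divide_distrib by simp
  then have "exp (- (cmod (of_real (- b / a) * y + of_real (1 / a) * w))\<^sup>2) * exp (- (cmod y)\<^sup>2)
      = exp (- (cmod w)\<^sup>2 / v) * exp (- (cmod (y - of_real (b / v) * w))\<^sup>2 / (a\<^sup>2 / v))"
    unfolding exp_add[symmetric] by simp
  then show ?thesis
    using v assms by (simp add: cn_density_def divide_simps) 
qed

text \<open>At fixed \<open>y\<close> the variable \<open>w = a x + b y\<close> replaces
  \<open>x\<close>; completing the square factors the integrand into the density of \<open>w\<close>
  and a conditional density of \<open>y\<close>, which integrates to 1. The substitution divides by
  \<open>a\<close>.\<close>

lemma distr_CN1_pair_aux:
  fixes a b :: real
  assumes "a \<noteq> 0"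
  shows "distr (CN1 \<Otimes>\<^sub>M CN1) borel (\<lambda>(x, y). of_real a * x + of_real b * y)
    = density lborel (\<lambda>w. ennreal (cn_density (a\<^sup>2 + b\<^sup>2) w))"
proof (rule measure_eqI)
  interpret C: prob_space CN1
    by (rule prob_space_CN1)
  interpret CC: pair_sigma_finite CN1 CN1 ..
  define v where "v = a\<^sup>2 + b\<^sup>2"
  have v: "0 < v"
    using assms by (simp add: v_def sum_power2_gt_zero_iff)
  fix A
  assume "A \<in> sets (distr (CN1 \<Otimes>\<^sub>M CN1) borel (\<lambda>(x, y). complex_of_real a * x + of_real b * y))"
  then have A [measurable]: "A \<in> sets borel"
    by simp
  have "emeasure (distr (CN1 \<Otimes>\<^sub>M CN1) borel (\<lambda>(x, y). of_real a * x + of_real b * y)) A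
      = (\<integral>\<^sup>+y. \<integral>\<^sup>+x. indicator A (of_real a * x + of_real b * y) \<partial>CN1 \<partial>CN1)"
  proof -
    have "emeasure (distr (CN1 \<Otimes>\<^sub>M CN1) borel (\<lambda>(x, y). of_real a * x + of_real b * y)) A
        = (\<integral>\<^sup>+w. indicator A w \<partial>distr (CN1 \<Otimes>\<^sub>M CN1) borel (\<lambda>(x, y). of_real a * x + of_real b * y))"
      by simp
    also have "\<dots> = (\<integral>\<^sup>+p. indicator A (of_real a * fst p + of_real b * snd p) \<partial>(CN1 \<Otimes>\<^sub>M CN1))"
      by (subst nn_integral_distr) (simp_all add: case_prod_beta)
    also have "\<dots> = (\<integral>\<^sup>+y. \<integral>\<^sup>+x. indicator A (of_real a * x + of_real b * y) \<partial>CN1 \<partial>CN1)"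
      by (subst CC.nn_integral_snd[symmetric]) simp_all
    finally show ?thesis .
  qed
  also have "\<dots> = (\<integral>\<^sup>+y. ennreal (cn_density 1 y) *
      (\<integral>\<^sup>+x. ennreal (cn_density 1 x) * indicator A (of_real a * x + of_real b * y) \<partial>lborel) \<partial>lborel)"
    unfolding CN1_eq by (simp add: nn_integral_density)
  \<comment> \<open>Substitution \<open>x = w / a - b y / a\<close>; its Jacobian in two real
    dimensions is \<open>1 / a\<^sup>2\<close>.\<close>
  also have "\<dots> = (\<integral>\<^sup>+y. ennreal (cn_density 1 y) * (ennreal (1 / a\<^sup>2) *
      (\<integral>\<^sup>+w. ennreal (cn_density 1 (of_real (- b / a) * y + of_real (1 / a) * w)) * indicator A w \<partial>lborel)) \<partial>lborel)"
  proof (rule nn_integral_cong)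
    fix y :: complex
    have "of_real a * (of_real (- b / a) * y + of_real (1 / a) * w) + of_real b * y = w" for w
      using assms by (simp add: field_simps)
    then have "(\<integral>\<^sup>+x. ennreal (cn_density 1 x) * indicator A (of_real a * x + of_real b * y) \<partial>lborel)
        = ennreal (1 / a\<^sup>2) *
          (\<integral>\<^sup>+w. ennreal (cn_density 1 (of_real (- b / a) * y + of_real (1 / a) * w)) * indicator A w \<partial>lborel)"
      using assms
      by (subst nn_integral_lborel_affine[where c = "1 / a" and t = "of_real (- b / a) * y"])
        (simp_all only: power_divide, simp_all)
    then show "ennreal (cn_density 1 y) *
        (\<integral>\<^sup>+x. ennreal (cn_density 1 x) * indicator A (of_real a * x + of_real b * y) \<partial>lborel)
      = ennreal (cn_density 1 y) * (ennreal (1 / a\<^sup>2) *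
        (\<integral>\<^sup>+w. ennreal (cn_density 1 (of_real (- b / a) * y + of_real (1 / a) * w)) * indicator A w \<partial>lborel))"
      by simp
  qed
  also have "\<dots> = (\<integral>\<^sup>+y. \<integral>\<^sup>+w. ennreal (cn_density 1 (of_real (- b / a) * y + of_real (1 / a) * w)
      * cn_density 1 y / a\<^sup>2) * indicator A w \<partial>lborel \<partial>lborel)"
    by (intro nn_integral_cong, subst nn_integral_cmult[symmetric], simp, subst nn_integral_cmult[symmetric], simp)
      (auto intro!: nn_integral_cong split: split_indicator simp: cn_density_nonneg mult_ac simp flip: ennreal_mult')
  also have "\<dots> = (\<integral>\<^sup>+y. \<integral>\<^sup>+w. ennreal (cn_density v w * cn_density (a\<^sup>2 / v) (y - of_real (b / v) * w))
      * indicator A w \<partial>lborel \<partial>lborel)"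
    by (simp only: cn_density_convolve[OF assms] v_def)
  also have "\<dots> = (\<integral>\<^sup>+w. \<integral>\<^sup>+y. ennreal (cn_density v w * cn_density (a\<^sup>2 / v) (y - of_real (b / v) * w))
      * indicator A w \<partial>lborel \<partial>lborel)"
    by (intro lborel_pair.Fubini') simp
  also have "\<dots> = (\<integral>\<^sup>+w. ennreal (cn_density v w) * indicator A w *
      (\<integral>\<^sup>+y. ennreal (cn_density (a\<^sup>2 / v) (y - of_real (b / v) * w)) \<partial>lborel) \<partial>lborel)"
    using v assms
    by (intro nn_integral_cong, subst nn_integral_cmult[symmetric])
      (auto simp: ennreal_mult cn_density_nonneg mult_ac intro!: nn_integral_cong)
  also have "\<dots> = (\<integral>\<^sup>+w. ennreal (cn_density v w) * indicator A w \<partial>lborel)"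
  proof (rule nn_integral_cong)
    fix w :: complex
    \<comment> \<open>Translation invariance removes the shift by the conditional mean.\<close>
    have "(\<integral>\<^sup>+y. ennreal (cn_density (a\<^sup>2 / v) (y - of_real (b / v) * w)) \<partial>lborel) = 1"
      using nn_integral_lborel_affine[where c = 1 and t = "- (of_real (b / v) * w)"
          and f = "\<lambda>y. ennreal (cn_density (a\<^sup>2 / v) y)"] v assms
      by (simp add: nn_integral_cn_density)
    then show "ennreal (cn_density v w) * indicator A w *
      (\<integral>\<^sup>+y. ennreal (cn_density (a\<^sup>2 / v) (y - of_real (b / v) * w)) \<partial>lborel)
      = ennreal (cn_density v w) * indicator A w"
      by simp
  qed
  finally show "emeasure (distr (CN1 \<Otimes>\<^sub>M CN1) borel (\<lambda>(x, y). of_real a * x + of_real b * y)) A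
      = emeasure (density lborel (\<lambda>w. ennreal (cn_density (a\<^sup>2 + b\<^sup>2) w))) A"
    by (simp add: emeasure_density v_def)
qed simp

text \<open>If \<open>a = 0\<close> then \<open>b\<close> is nonzero, and exchanging the two
  independent coordinates brings the nonzero coefficient to the front.\<close>

lemma distr_CN1_pair:
  fixes a b :: real
  assumes "a\<^sup>2 + b\<^sup>2 \<noteq> 0"
  shows "distr (CN1 \<Otimes>\<^sub>M CN1) borel (\<lambda>(x, y). of_real a * x + of_real b * y)
    = density lborel (\<lambda>w. ennreal (cn_density (a\<^sup>2 + b\<^sup>2) w))"
proof (cases "a = 0")
  case True
  interpret C: prob_space CN1
    by (rule prob_space_CN1)
  interpret CC: pair_sigma_finite CN1 CN1 ..
  have "distr (CN1 \<Otimes>\<^sub>M CN1) borel (\<lambda>(x, y). of_real a * x + of_real b * y)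
      = distr (CN1 \<Otimes>\<^sub>M CN1) borel (\<lambda>(x, y). of_real b * x + complex_of_real a * y)"
    by (subst CC.distr_pair_swap) (simp add: distr_distr comp_def case_prod_unfold add.commute)
  with True assms show ?thesis
    using distr_CN1_pair_aux[of b a] by (simp add: add.commute)
qed (rule distr_CN1_pair_aux)

lemma CN_one: "CN 1 = CN1"
  by (simp add: CN_def distr_id2)

text \<open>By independence the joint law of \<open>g\<close> and \<open>n\<close> is a product.
  Taking the law of \<open>n\<close> as the image of the standard law under scaling by the absolute
  value of \<sigma> includes the noiseless case, a point mass; the sum still has a density because
  the total variance is positive.\<close>

lemma distr_gaussian_combination:
  assumes P: "prob_space P" and indep: "prob_space.indep_var P borel g borel n"
    and g: "distr P borel g = CN 1" and n: "distr P borel n = CN (\<sigma>\<^sup>2)"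
    and pos: "a\<^sup>2 + \<sigma>\<^sup>2 \<noteq> 0"
  shows "distr P borel (\<lambda>\<omega>. of_real a * g \<omega> + n \<omega>)
    = density lborel (\<lambda>w. ennreal (cn_density (a\<^sup>2 + \<sigma>\<^sup>2) w))"
proof -
  interpret prob_space P by fact
  interpret C: prob_space CN1 by (rule prob_space_CN1)
  have rv [measurable]: "g \<in> borel_measurable P" "n \<in> borel_measurable P"
    using indep_var_rv1[OF indep] indep_var_rv2[OF indep] by auto
  let ?h = "\<lambda>x. complex_of_real \<bar>\<sigma>\<bar> * x"
  have id: "distr CN1 borel (\<lambda>x. x) = CN1"
    by (simp add: distr_id2)
  have h [measurable]: "?h \<in> measurable CN1 borel"
    by measurable
  have "prob_space (distr CN1 borel ?h)"
    by (rule C.prob_space_distr) simp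
  then have sf: "sigma_finite_measure (distr CN1 borel ?h)"
    by (simp add: prob_space.axioms(1) finite_measure.axioms(1))
  have "distr P (borel \<Otimes>\<^sub>M borel) (\<lambda>\<omega>. (g \<omega>, n \<omega>)) = CN 1 \<Otimes>\<^sub>M CN (\<sigma>\<^sup>2)"
    using indep unfolding indep_var_distribution_eq by (simp add: g n)
  also have "\<dots> = distr CN1 borel (\<lambda>x. x) \<Otimes>\<^sub>M distr CN1 borel ?h"
    by (simp only: CN_one id) (simp add: CN_def)
  also have "\<dots> = distr (CN1 \<Otimes>\<^sub>M CN1) (borel \<Otimes>\<^sub>M borel) (\<lambda>(x, y). (x, ?h y))"
    using pair_measure_distr[OF _ h sf, of "\<lambda>x. x" CN1 borel] by simp
  finally have joint: "distr P (borel \<Otimes>\<^sub>M borel) (\<lambda>\<omega>. (g \<omega>, n \<omega>))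
      = distr (CN1 \<Otimes>\<^sub>M CN1) (borel \<Otimes>\<^sub>M borel) (\<lambda>(x, y). (x, ?h y))" .
  have "distr P borel (\<lambda>\<omega>. of_real a * g \<omega> + n \<omega>)
      = distr (distr P (borel \<Otimes>\<^sub>M borel) (\<lambda>\<omega>. (g \<omega>, n \<omega>))) borel (\<lambda>p. of_real a * fst p + snd p)"
    by (subst distr_distr) (auto simp: comp_def)
  also have "\<dots> = distr (CN1 \<Otimes>\<^sub>M CN1) borel (\<lambda>(x, y). of_real a * x + of_real \<bar>\<sigma>\<bar> * y)"
    unfolding joint by (subst distr_distr) (auto simp: comp_def case_prod_unfold)
  also have "\<dots> = density lborel (\<lambda>w. ennreal (cn_density (a\<^sup>2 + \<sigma>\<^sup>2) w))"
    using distr_CN1_pair[of a "\<bar>\<sigma>\<bar>"] pos by simp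
  finally show ?thesis .
qed

section \<open>Gaussian measure of polygonal shells\<close>

text \<open>The images of the \<open>E i\<close> under their affine functions are disjoint subsets of \<open>{t..t + e}\<close>: two
  active functions with slopes of the same sign cannot take the same value at two points.\<close>

lemma active_slopes_same_sign:
  fixes a b :: "'i \<Rightarrow> real"
  assumes "finite I" and E [measurable]: "\<And>i. i \<in> I \<Longrightarrow> E i \<in> sets borel"
    and disj: "disjoint_family_on E I"
    and act: "\<And>i j x. i \<in> I \<Longrightarrow> j \<in> I \<Longrightarrow> x \<in> E i \<Longrightarrow> a j * x + b j \<le> a i * x + b i"
    and range: "\<And>i x. i \<in> I \<Longrightarrow> x \<in> E i \<Longrightarrow> a i * x + b i \<in> {t..t + e}"
    and sign: "(\<forall>i\<in>I. 0 < a i) \<or> (\<forall>i\<in>I. a i < 0)" and "0 \<le> e"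
  shows "(\<Sum>i\<in>I. ennreal \<bar>a i\<bar> * emeasure lborel (E i)) \<le> ennreal e"
proof -
  \<comment> \<open>The image of \<open>E i\<close> under \<open>x \<mapsto> a i * x + b i\<close>,
    written as a preimage under the inverse map so that it is visibly Borel.\<close>
  define F where "F i = (\<lambda>y. (y - b i) / a i) -` E i" for i
  have nz: "a i \<noteq> 0" if "i \<in> I" for i
    using sign that by force
  have F [measurable]: "F i \<in> sets borel" if "i \<in> I" for i
  proof -
    have [measurable]: "E i \<in> sets borel" using E that .
    have "(\<lambda>y. (y - b i) / a i) -` E i \<inter> space borel \<in> sets borel"
      by measurable
    then show ?thesis
      by (simp add: F_def)
  qed
  have eq: "a i * ((y - b i) / a i) + b i = y" if "i \<in> I" for i y
    using nz[OF that] by simp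
  have "emeasure lborel (F i) = ennreal \<bar>a i\<bar> * emeasure lborel (E i)" if "i \<in> I" for i
  proof -
    have [measurable]: "F i \<in> sets borel" "E i \<in> sets borel"
      using F E that by auto
    have "emeasure lborel (F i) = (\<integral>\<^sup>+y. indicator (F i) y \<partial>lborel)"
      by simp
    also have "\<dots> = ennreal \<bar>a i\<bar> * (\<integral>\<^sup>+x. indicator (F i) (b i + a i * x) \<partial>lborel)"
      using nz[OF that] by (intro nn_integral_real_affine) auto
    also have "(\<lambda>x. indicator (F i) (b i + a i * x)) = (indicator (E i) :: real \<Rightarrow> ennreal)"
      using nz[OF that] by (auto simp: F_def fun_eq_iff split: split_indicator)
    finally show ?thesis
      by simp
  qed
  then have "(\<Sum>i\<in>I. ennreal \<bar>a i\<bar> * emeasure lborel (E i)) = (\<Sum>i\<in>I. emeasure lborel (F i))"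
    by simp
  also have "\<dots> = emeasure lborel (\<Union>i\<in>I. F i)"
  proof (rule sum_emeasure)
    show "disjoint_family_on F I"
      unfolding disjoint_family_on_def
    proof (intro ballI impI, rule ccontr)
      fix i j
      assume ij: "i \<in> I" "j \<in> I" "i \<noteq> j" and "F i \<inter> F j \<noteq> {}"
      then obtain y where y: "(y - b i) / a i \<in> E i" "(y - b j) / a j \<in> E j"
        by (auto simp: F_def)
      define x x' where "x = (y - b i) / a i" and "x' = (y - b j) / a j"
      have E: "x \<in> E i" "x' \<in> E j" and val: "a i * x + b i = y" "a j * x' + b j = y"
        using y eq ij by (auto simp: x_def x'_def)
      have "x \<noteq> x'"
        using E ij disj by (auto simp: disjoint_family_on_def)
      \<comment> \<open>Each function is dominated at the point where the other is active, and both
        active values equal \<open>y\<close>. With slopes of one sign the two inequalities order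
        \<open>x\<close> and \<open>x'\<close> in opposite ways.\<close>
      moreover have "a j * x \<le> a j * x'" "a i * x' \<le> a i * x"
        using act[OF ij(1,2) E(1)] act[OF ij(2,1) E(2)] val by linarith+
      ultimately show False
        using sign ij by (metis linorder_neqE_linordered_idom mult_less_cancel_left_pos
            mult_less_cancel_left_neg not_le)
    qed
  qed (use F \<open>finite I\<close> in auto)
  also have "\<dots> \<le> emeasure lborel {t..t + e}"
  proof (rule emeasure_mono)
    show "(\<Union>i\<in>I. F i) \<subseteq> {t..t + e}"
    proof safe
      fix i y
      assume "i \<in> I" "y \<in> F i"
      then show "y \<in> {t..t + e}"
        using range[of i "(y - b i) / a i"] eq[of i y] by (auto simp: F_def)
    qed
  qed simp
  also have "\<dots> = ennreal e"
    using \<open>0 \<le> e\<close> by simp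
  finally show ?thesis .
qed

text \<open>The maximum of affine functions is convex: it crosses the band once on its decreasing
  branch and once on its increasing one, each costing \<open>e\<close>. Zero slopes contribute
  nothing.\<close>

lemma active_slopes:
  fixes a b :: "'i \<Rightarrow> real"
  assumes "finite I" and E: "\<And>i. i \<in> I \<Longrightarrow> E i \<in> sets borel"
    and disj: "disjoint_family_on E I"
    and act: "\<And>i j x. i \<in> I \<Longrightarrow> j \<in> I \<Longrightarrow> x \<in> E i \<Longrightarrow> a j * x + b j \<le> a i * x + b i"
    and range: "\<And>i x. i \<in> I \<Longrightarrow> x \<in> E i \<Longrightarrow> a i * x + b i \<in> {t..t + e}"
    and "0 \<le> e"
  shows "(\<Sum>i\<in>I. ennreal \<bar>a i\<bar> * emeasure lborel (E i)) \<le> ennreal (2 * e)"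
proof -
  let ?s = "\<lambda>J. \<Sum>i\<in>J. ennreal \<bar>a i\<bar> * emeasure lborel (E i)"
  have same_sign: "?s {i \<in> I. Q (a i)} \<le> ennreal e"
    if "(\<forall>x. Q x \<longrightarrow> 0 < x) \<or> (\<forall>x. Q x \<longrightarrow> x < 0)" for Q
    using that assms
    by (intro active_slopes_same_sign[where b = b and t = t]) (auto simp: disjoint_family_on_def)
  have "?s I = ?s ({i \<in> I. 0 < a i} \<union> {i \<in> I. a i < 0})"
    using \<open>finite I\<close> by (intro sum.mono_neutral_right) (auto simp: not_less antisym)
  also have "\<dots> = ?s {i \<in> I. 0 < a i} + ?s {i \<in> I. a i < 0}"
    using \<open>finite I\<close> by (intro sum.union_disjoint) auto
  also have "\<dots> \<le> ennreal e + ennreal e"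
    by (intro add_mono same_sign[of "\<lambda>x. 0 < x"] same_sign[of "\<lambda>x. x < 0"]) auto
  also have "\<dots> = ennreal (2 * e)"
    using \<open>0 \<le> e\<close> by (simp flip: ennreal_plus)
  finally show ?thesis .
qed

section \<open>The shell bound in the plane\<close>

text \<open>Slicing along the two coordinate axes suffices since a unit normal \<open>u\<close> satisfies
  \<open>\<bar>Re u\<bar> + \<bar>Im u\<bar> \<ge> 1\<close>; averaging over all directions would improve the constant
  \<open>4 / sqrt pi\<close> to \<open>sqrt pi\<close>.\<close>

lemma gaussian_polygon_shell:
  fixes u :: "'i \<Rightarrow> complex" and c :: "'i \<Rightarrow> real"
  assumes "finite I" and u: "\<And>i. i \<in> I \<Longrightarrow> cmod (u i) = 1" and v: "0 < v" and "0 \<le> e"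
  shows "emeasure (density lborel (\<lambda>w. ennreal (cn_density v w)))
      {w. (\<exists>i\<in>I. t \<le> Re (u i * w) + c i) \<and> (\<forall>i\<in>I. Re (u i * w) + c i \<le> t + e)}
    \<le> ennreal (4 * e / sqrt (pi * v))" (is "emeasure ?M ?A \<le> _")
proof -
  obtain f :: "'i \<Rightarrow> nat" where f: "inj_on f I"
    using finite_imp_inj_to_nat_seg[OF \<open>finite I\<close>] by auto
  define l where "l i w = Re (u i * w) + c i" for i w
  define act where "act i w \<longleftrightarrow> (\<forall>j\<in>I. l j w \<le> l i w) \<and> t \<le> l i w \<and> l i w \<le> t + e" for i w
  \<comment> \<open>The part of the shell where side \<open>i\<close> attains the maximum. Ties go
    to the side with the smallest number under \<open>f\<close>, which makes the parts
    disjoint.\<close>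
  define B where "B i = {w. act i w \<and> (\<forall>j\<in>{j \<in> I. f j < f i}. \<not> act j w)}" for i
  have [measurable]: "l i \<in> borel_measurable borel" for i
    unfolding l_def by measurable
  have B [measurable]: "B i \<in> sets borel" for i
  proof -
    have [measurable]: "Measurable.pred borel (act i)" for i
    proof -
      have "Measurable.pred borel (\<lambda>w. \<forall>j\<in>I. l j w \<le> l i w)"
        using \<open>finite I\<close> by (intro pred_intros_finite) measurable
      then show ?thesis
        unfolding act_def by measurable
    qed
    have "Measurable.pred borel (\<lambda>w. \<forall>j\<in>{j \<in> I. f j < f i}. \<not> act j w)"
      using \<open>finite I\<close> by (intro pred_intros_finite) measurable
    then show ?thesis
      unfolding B_def by measurable
  qed
  have disj: "disjoint_family_on B I"
    using f by (force simp: disjoint_family_on_def B_def inj_on_def disjoint_iff linorder_neq_iff)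
  have "?A \<subseteq> (\<Union>i\<in>I. B i)"
  proof
    fix w
    assume "w \<in> ?A"
    then obtain k where k: "k \<in> I" "t \<le> l k w" and le: "\<forall>i\<in>I. l i w \<le> t + e"
      by (auto simp: l_def)
    have fin: "finite ((\<lambda>i. l i w) ` I)" "(\<lambda>i. l i w) ` I \<noteq> {}"
      using \<open>finite I\<close> k by auto
    obtain i where "i \<in> I" "Max ((\<lambda>i. l i w) ` I) = l i w"
      using Max_in[OF fin] by auto
    then have "i \<in> I" "\<forall>j\<in>I. l j w \<le> l i w"
      using Max_ge[OF fin(1)] by fastforce+
    then have "act i w"
      using k le by (force simp: act_def)
    then show "w \<in> (\<Union>i\<in>I. B i)"
    proof -
      have ex: "\<exists>j. j \<in> I \<and> act j w"
        using \<open>i \<in> I\<close> \<open>act i w\<close> by auto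
      define j where "j = arg_min f (\<lambda>j. j \<in> I \<and> act j w)"
      have "(j \<in> I \<and> act j w) \<and> (\<forall>k. k \<in> I \<and> act k w \<longrightarrow> f j \<le> f k)"
        unfolding j_def using ex by (rule exE) (rule arg_min_nat_lemma)
      then show ?thesis
        by (auto simp: B_def not_less intro!: bexI[of _ j] dest: leD)
    qed
  qed
  then have "emeasure ?M ?A \<le> emeasure ?M (\<Union>i\<in>I. B i)"
    using \<open>finite I\<close> by (intro emeasure_mono) auto
  also have "\<dots> \<le> (\<Sum>i\<in>I. emeasure ?M (B i))"
    using \<open>finite I\<close> by (intro emeasure_subadditive_finite) auto
  also have "\<dots> \<le> (\<Sum>i\<in>I. ennreal \<bar>Re (u i)\<bar> * emeasure ?M (B i) + ennreal \<bar>Im (u i)\<bar> * emeasure ?M (B i))"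
  proof (rule sum_mono)
    fix i
    assume "i \<in> I"
    then have "1 \<le> \<bar>Re (u i)\<bar> + \<bar>Im (u i)\<bar>"
      using cmod_le[of "u i"] u by simp
    then have "ennreal 1 \<le> ennreal \<bar>Re (u i)\<bar> + ennreal \<bar>Im (u i)\<bar>"
      by (simp flip: ennreal_plus)
    from mult_right_mono[OF this, of "emeasure ?M (B i)"]
    show "emeasure ?M (B i) \<le> ennreal \<bar>Re (u i)\<bar> * emeasure ?M (B i) + ennreal \<bar>Im (u i)\<bar> * emeasure ?M (B i)"
      by (simp add: distrib_right)
  qed
  also have "\<dots> = (\<Sum>i\<in>I. ennreal \<bar>Re (u i)\<bar> * emeasure ?M (B i)) + (\<Sum>i\<in>I. ennreal \<bar>Im (u i)\<bar> * emeasure ?M (B i))"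
    by (rule sum.distrib)
  also have "\<dots> \<le> ennreal (2 * e / sqrt (pi * v)) + ennreal (2 * e / sqrt (pi * v))"
  proof (rule add_mono)
    \<comment> \<open>\<open>Cx\<close> stands for \<open>Complex\<close> with its arguments in
      either order, so one computation serves both slicing directions. On each line with
      \<open>y\<close> fixed the sides are affine in \<open>x\<close> with slopes
      \<open>a i\<close>.\<close>
    have slice: "(\<Sum>i\<in>I. ennreal \<bar>a i\<bar> * (\<integral>\<^sup>+y. \<integral>\<^sup>+x. ennreal (cn_marginal_density v x * cn_marginal_density v y) * indicator (B i) (Cx x y) \<partial>lborel \<partial>lborel))
        \<le> ennreal (2 * e / sqrt (pi * v))"
      if [measurable]: "(\<lambda>p. Cx (fst p) (snd p)) \<in> borel_measurable (borel \<Otimes>\<^sub>M borel)"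
        and Cx: "\<And>i x y. Re (u i * Cx x y) = a i * x + b i y"
      for a :: "'i \<Rightarrow> real" and b and Cx :: "real \<Rightarrow> real \<Rightarrow> complex"
    proof -
      have affine: "a i * x + (b i y + c i) = l i (Cx x y)" for i x y
        by (simp only: l_def Cx add.assoc)
      have [measurable]: "{x. Cx x y \<in> B i} \<in> sets borel" for i y
      proof -
        have "(\<lambda>x. Cx x y) \<in> borel_measurable borel"
          using measurable_compose[of "\<lambda>x. (x, y)" borel "borel \<Otimes>\<^sub>M borel", OF _ that(1)] by simp
        from measurable_sets[OF this B, of i] show ?thesis
          by (simp add: vimage_def)
      qed
      have Cx_swap: "(\<lambda>p. Cx (snd p) (fst p)) \<in> borel_measurable (lborel \<Otimes>\<^sub>M lborel)"
        using measurable_compose[of "\<lambda>p. (snd p, fst p)" "lborel \<Otimes>\<^sub>M lborel" "borel \<Otimes>\<^sub>M borel", OF _ that(1)]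
        by simp
      have [measurable]: "(\<lambda>y. \<integral>\<^sup>+x. ennreal (cn_marginal_density v x * cn_marginal_density v y) * indicator (B i) (Cx x y) \<partial>lborel) \<in> borel_measurable lborel" for i
        using measurable_compose[OF Cx_swap, of "indicator (B i) :: complex \<Rightarrow> ennreal" borel]
        by (intro lborel.borel_measurable_nn_integral) (simp add: case_prod_unfold)
      have "(\<Sum>i\<in>I. ennreal \<bar>a i\<bar> * (\<integral>\<^sup>+y. \<integral>\<^sup>+x. ennreal (cn_marginal_density v x * cn_marginal_density v y) * indicator (B i) (Cx x y) \<partial>lborel \<partial>lborel))
          = (\<integral>\<^sup>+y. (\<Sum>i\<in>I. ennreal \<bar>a i\<bar> * (\<integral>\<^sup>+x. ennreal (cn_marginal_density v x * cn_marginal_density v y) * indicator (B i) (Cx x y) \<partial>lborel)) \<partial>lborel)"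
        by (simp add: nn_integral_cmult nn_integral_sum)
      also have "\<dots> \<le> (\<integral>\<^sup>+y. ennreal (cn_marginal_density v y) * ennreal (2 * e / sqrt (pi * v)) \<partial>lborel)"
      proof (rule nn_integral_mono)
        fix y
        \<comment> \<open>The marginal density in the slicing direction is at most its value
          \<open>1 / sqrt (pi * v)\<close> at 0; what remains is the slope-weighted length bounded
          by \<open>active_slopes\<close>.\<close>
        have "(\<Sum>i\<in>I. ennreal \<bar>a i\<bar> * (\<integral>\<^sup>+x. ennreal (cn_marginal_density v x * cn_marginal_density v y) * indicator (B i) (Cx x y) \<partial>lborel))
          \<le> (\<Sum>i\<in>I. ennreal \<bar>a i\<bar> * (\<integral>\<^sup>+x. ennreal (1 / sqrt (pi * v) * cn_marginal_density v y) * indicator {x. Cx x y \<in> B i} x \<partial>lborel))"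
          using v cn_marginal_density_le[OF v]
          by (intro sum_mono mult_left_mono nn_integral_mono)
            (auto split: split_indicator intro!: ennreal_leI mult_right_mono cn_marginal_density_nonneg simp del: times_divide_eq_left mult_1_left)
        also have "\<dots> = ennreal (1 / sqrt (pi * v) * cn_marginal_density v y) * (\<Sum>i\<in>I. ennreal \<bar>a i\<bar> * emeasure lborel {x. Cx x y \<in> B i})"
          by (simp add: nn_integral_cmult_indicator sum_distrib_left mult_ac)
        also have "\<dots> \<le> ennreal (1 / sqrt (pi * v) * cn_marginal_density v y) * ennreal (2 * e)"
        proof (intro mult_left_mono active_slopes)
          show "disjoint_family_on (\<lambda>i. {x. Cx x y \<in> B i}) I"
            using disj by (auto simp: disjoint_family_on_def)
          show "a j * x + (b j y + c j) \<le> a i * x + (b i y + c i)"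
            if "i \<in> I" "j \<in> I" "x \<in> {x. Cx x y \<in> B i}" for i j x
            using that unfolding affine by (auto simp: B_def act_def)
          show "a i * x + (b i y + c i) \<in> {t..t + e}"
            if "i \<in> I" "x \<in> {x. Cx x y \<in> B i}" for i x
            using that unfolding affine by (auto simp: B_def act_def)
        qed (use assms in auto)
        also have "\<dots> = ennreal (cn_marginal_density v y) * ennreal (2 * e / sqrt (pi * v))"
          using v cn_marginal_density_nonneg[OF v] \<open>0 \<le> e\<close> by (simp add: mult_ac flip: ennreal_mult)
        finally show "(\<Sum>i\<in>I. ennreal \<bar>a i\<bar> * (\<integral>\<^sup>+x. ennreal (cn_marginal_density v x * cn_marginal_density v y) * indicator (B i) (Cx x y) \<partial>lborel))
          \<le> ennreal (cn_marginal_density v y) * ennreal (2 * e / sqrt (pi * v))" .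
      qed
      also have "\<dots> = ennreal (2 * e / sqrt (pi * v))"
        by (simp add: nn_integral_multc nn_integral_cn_marginal_density[OF v])
      finally show ?thesis .
    qed
    have M: "emeasure ?M (B i) = (\<integral>\<^sup>+w. ennreal (cn_density v w) * indicator (B i) w \<partial>lborel)" for i
      by (simp add: emeasure_density)
    \<comment> \<open>Since \<open>Re (u * Complex x y)\<close> is
      \<open>Re u * x - Im u * y\<close>, the slopes are \<open>Re (u i)\<close> along horizontal
      lines and \<open>- Im (u i)\<close> along vertical ones.\<close>
    show "(\<Sum>i\<in>I. ennreal \<bar>Re (u i)\<bar> * emeasure ?M (B i)) \<le> ennreal (2 * e / sqrt (pi * v))"
      using slice[of Complex "\<lambda>i. Re (u i)" "\<lambda>i y. - Im (u i) * y"] v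
      by (simp add: M nn_integral_lborel_complex(1) cn_density_Complex)
    show "(\<Sum>i\<in>I. ennreal \<bar>Im (u i)\<bar> * emeasure ?M (B i)) \<le> ennreal (2 * e / sqrt (pi * v))"
      using slice[of "\<lambda>y x. Complex x y" "\<lambda>i. - Im (u i)" "\<lambda>i y. Re (u i) * y"] v
      by (simp add: M nn_integral_lborel_complex(2) cn_density_Complex mult.commute)
  qed
  also have "\<dots> = ennreal (4 * e / sqrt (pi * v))"
    using v \<open>0 \<le> e\<close> by (simp flip: ennreal_plus)
  finally show ?thesis .
qed

section \<open>Voronoi cells and decoding errors\<close>

text \<open>The signed distance of \<open>y\<close> from the set where \<open>\<beta> * y\<close> is equally far from \<open>z\<close> and \<open>x\<close>,
  positive on the side of \<open>x\<close>.\<close>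

definition bisector_dist :: "complex \<Rightarrow> complex \<Rightarrow> complex \<Rightarrow> complex \<Rightarrow> real" where
  "bisector_dist \<beta> z x y = Re (\<beta> * cnj (x - z) / of_real (cmod (\<beta> * (x - z))) * y)
     + ((cmod z)\<^sup>2 - (cmod x)\<^sup>2) / (2 * cmod (\<beta> * (x - z)))"

text \<open>The square of \<open>cmod (\<beta> * y)\<close> cancels in the difference, leaving an
  affine function of \<open>y\<close> whose gradient has length
  \<open>2 * cmod (\<beta> * (x - z))\<close>; dividing by it gives a signed distance.\<close>

lemma bisector_dist_eq:
  assumes "\<beta> \<noteq> 0" "x \<noteq> z"
  shows "2 * cmod (\<beta> * (x - z)) * bisector_dist \<beta> z x y = (dist (\<beta> * y) z)\<^sup>2 - (dist (\<beta> * y) x)\<^sup>2"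
proof -
  have "cmod (\<beta> * (x - z)) \<noteq> 0"
    using assms by simp
  then have "2 * cmod (\<beta> * (x - z)) * bisector_dist \<beta> z x y
      = 2 * Re (\<beta> * y * cnj (x - z)) + ((cmod z)\<^sup>2 - (cmod x)\<^sup>2)"
    unfolding bisector_dist_def times_divide_eq_left Re_divide_of_real
    by (simp add: distrib_left mult_ac del: complex_cnj_diff times_complex.sel)
  also have "\<dots> = (dist (\<beta> * y) z)\<^sup>2 - (dist (\<beta> * y) x)\<^sup>2"
    unfolding dist_norm cmod_power2 by (simp add: power2_eq_square algebra_simps)
  finally show ?thesis .
qed

lemma bisector_dist_sign:
  assumes "\<beta> \<noteq> 0" "x \<noteq> z"
  shows "bisector_dist \<beta> z x y \<le> 0 \<longleftrightarrow> dist (\<beta> * y) z \<le> dist (\<beta> * y) x"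
    and "0 \<le> bisector_dist \<beta> z x y \<longleftrightarrow> dist (\<beta> * y) x \<le> dist (\<beta> * y) z"
proof -
  have pos: "0 < 2 * cmod (\<beta> * (x - z))"
    using assms by simp
  have "bisector_dist \<beta> z x y \<le> 0 \<longleftrightarrow> 2 * cmod (\<beta> * (x - z)) * bisector_dist \<beta> z x y \<le> 0"
    using pos by (simp only: mult_le_0_iff) linarith
  then show "bisector_dist \<beta> z x y \<le> 0 \<longleftrightarrow> dist (\<beta> * y) z \<le> dist (\<beta> * y) x"
    unfolding bisector_dist_eq[OF assms] by (simp add: power_mono_iff)
  have "0 \<le> bisector_dist \<beta> z x y \<longleftrightarrow> 0 \<le> 2 * cmod (\<beta> * (x - z)) * bisector_dist \<beta> z x y"
    using pos by (simp only: zero_le_mult_iff) linarith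
  then show "0 \<le> bisector_dist \<beta> z x y \<longleftrightarrow> dist (\<beta> * y) x \<le> dist (\<beta> * y) z"
    unfolding bisector_dist_eq[OF assms] by (simp add: power_mono_iff)
qed

lemma bisector_dist_add:
  "bisector_dist \<beta> z x (m + w) = Re (\<beta> * cnj (x - z) / of_real (cmod (\<beta> * (x - z))) * w) + bisector_dist \<beta> z x m"
  unfolding bisector_dist_def by (simp only: distrib_left plus_complex.sel)

text \<open>The coefficient of \<open>y\<close> is a unit vector, so an observation error of size
  \<open>e\<close> moves every signed distance by at most \<open>e\<close>.\<close>

lemma bisector_dist_Lipschitz:
  assumes "\<beta> \<noteq> 0" "x \<noteq> z"
  shows "\<bar>bisector_dist \<beta> z x y - bisector_dist \<beta> z x y'\<bar> \<le> cmod (y - y')"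
proof -
  let ?u = "\<beta> * cnj (x - z) / of_real (cmod (\<beta> * (x - z)))"
  have "bisector_dist \<beta> z x y - bisector_dist \<beta> z x y' = Re (?u * (y - y'))"
    using bisector_dist_add[of \<beta> z x y' "y - y'"] by simp
  also have "\<bar>\<dots>\<bar> \<le> cmod (?u * (y - y'))"
    by (rule abs_Re_le_cmod)
  also have "\<dots> = cmod (y - y')"
    using assms by (simp add: norm_mult norm_divide del: complex_cnj_diff)
  finally show ?thesis .
qed

text \<open>The largest signed distance over \<open>x\<close> is at most 0 exactly on the closed
  Voronoi cell of \<open>z\<close>; the shell is where it lies in \<open>{t..t + e}\<close>. Here
  \<open>m\<close> is the noise-free part of the observation and \<open>w\<close> its Gaussian
  part.\<close>

definition cell_shell :: "complex set \<Rightarrow> complex \<Rightarrow> complex \<Rightarrow> complex \<Rightarrow> real \<Rightarrow> real \<Rightarrow> complex set" where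
  "cell_shell S \<beta> m z t e = {w. (\<exists>x\<in>S - {z}. t \<le> bisector_dist \<beta> z x (m + w)) \<and>
     (\<forall>x\<in>S - {z}. bisector_dist \<beta> z x (m + w) \<le> t + e)}"

text \<open>All signed distances at \<open>m + w\<close> are nonpositive, while the one belonging to
  the decision for \<open>y'\<close> is nonnegative at \<open>y'\<close> and hence at least
  \<open>- e\<close> at \<open>m + w\<close>. The weak inequalities cover every rule for
  ties.\<close>

lemma cell_shell_inner:
  assumes dec: "nearest_point_map S dec" and "\<beta> \<noteq> 0" and close: "cmod (y' - (m + w)) \<le> e"
    and "dec (\<beta> * (m + w)) = z" "dec (\<beta> * y') \<noteq> z"
  shows "w \<in> cell_shell S \<beta> m z (- e) e"
proof -
  let ?x = "dec (\<beta> * y')"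
  have S: "z \<in> S" "?x \<in> S - {z}"
    using dec assms(4,5) by (auto simp: nearest_point_map_def)
  then have "dist (\<beta> * y') ?x \<le> dist (\<beta> * y') z"
    using dec by (auto simp: nearest_point_map_def)
  then have "0 \<le> bisector_dist \<beta> z ?x y'"
    using bisector_dist_sign(2)[of \<beta> ?x z] assms by simp
  then have "- e \<le> bisector_dist \<beta> z ?x (m + w)"
    using bisector_dist_Lipschitz[of \<beta> ?x z y' "m + w"] assms close by linarith
  moreover have "bisector_dist \<beta> z x (m + w) \<le> 0" if "x \<in> S - {z}" for x
    using that dec assms bisector_dist_sign(1)[of \<beta> x z "m + w"] by (auto simp: nearest_point_map_def)
  ultimately show ?thesis
    using S(2) by (auto simp: cell_shell_def)
qed

text \<open>The mirror case: the signed distances are nonpositive at \<open>y'\<close>, hence at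
  most \<open>e\<close> at \<open>m + w\<close>, where the one belonging to the wrong decision is
  nonnegative.\<close>

lemma cell_shell_outer:
  assumes dec: "nearest_point_map S dec" and "\<beta> \<noteq> 0" and close: "cmod (y' - (m + w)) \<le> e"
    and "dec (\<beta> * (m + w)) \<noteq> z" "dec (\<beta> * y') = z"
  shows "w \<in> cell_shell S \<beta> m z 0 e"
proof -
  let ?x = "dec (\<beta> * (m + w))"
  have S: "z \<in> S" "?x \<in> S - {z}"
    using dec assms(4,5) by (auto simp: nearest_point_map_def)
  then have "dist (\<beta> * (m + w)) ?x \<le> dist (\<beta> * (m + w)) z"
    using dec by (auto simp: nearest_point_map_def)
  then have "0 \<le> bisector_dist \<beta> z ?x (m + w)"
    using bisector_dist_sign(2)[of \<beta> ?x z] assms by simp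
  moreover have "bisector_dist \<beta> z x (m + w) \<le> e" if "x \<in> S - {z}" for x
  proof -
    have "bisector_dist \<beta> z x y' \<le> 0"
      using that dec assms bisector_dist_sign(1)[of \<beta> x z y'] by (auto simp: nearest_point_map_def)
    then show ?thesis
      using bisector_dist_Lipschitz[of \<beta> x z y' "m + w"] that assms close by fastforce
  qed
  ultimately show ?thesis
    using S(2) by (auto simp: cell_shell_def)
qed

lemma sets_cell_shell [measurable]:
  assumes "finite S"
  shows "cell_shell S \<beta> m z t e \<in> sets borel"
proof -
  have [measurable]: "(\<lambda>w. bisector_dist \<beta> z x (m + w)) \<in> borel_measurable borel" for x
    unfolding bisector_dist_def by measurable
  have "Measurable.pred borel (\<lambda>w. (\<exists>x\<in>S - {z}. t \<le> bisector_dist \<beta> z x (m + w)) \<and>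
     (\<forall>x\<in>S - {z}. bisector_dist \<beta> z x (m + w) \<le> t + e))"
    using assms by (intro pred_intros_logic pred_intros_finite) measurable
  then show ?thesis
    unfolding cell_shell_def by measurable
qed

lemma emeasure_cell_shell:
  assumes "finite S" "\<beta> \<noteq> 0" "0 < v" "0 \<le> e"
  shows "emeasure (density lborel (\<lambda>w. ennreal (cn_density v w))) (cell_shell S \<beta> m z t e)
    \<le> ennreal (4 * e / sqrt (pi * v))"
  unfolding cell_shell_def bisector_dist_add
  using assms by (intro gaussian_polygon_shell) (auto simp: norm_mult norm_divide simp del: complex_cnj_diff)

section \<open>Measurability of the model quantities\<close>

lemma borel_measurable_complex_of_real:
  "f \<in> borel_measurable M \<Longrightarrow> (\<lambda>x. complex_of_real (f x)) \<in> borel_measurable M"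
  by measurable

lemma borel_measurable_cnj [measurable (raw)]:
  "f \<in> borel_measurable M \<Longrightarrow> (\<lambda>x. cnj (f x)) \<in> borel_measurable M"
  by (simp add: borel_measurable_complex_iff)

text \<open>The dimension is fixed at every \<omega>, so the dimension conditions of the vector
  operations hold pointwise.\<close>

definition measurable_vec :: "'w measure \<Rightarrow> nat \<Rightarrow> ('w \<Rightarrow> complex vec) \<Rightarrow> bool" where
  "measurable_vec M n F \<longleftrightarrow>
     (\<forall>\<omega>. F \<omega> \<in> carrier_vec n) \<and> (\<forall>i<n. (\<lambda>\<omega>. F \<omega> $ i) \<in> borel_measurable M)"

definition measurable_mat :: "'w measure \<Rightarrow> nat \<Rightarrow> nat \<Rightarrow> ('w \<Rightarrow> complex mat) \<Rightarrow> bool" where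
  "measurable_mat M m n A \<longleftrightarrow>
     (\<forall>\<omega>. A \<omega> \<in> carrier_mat m n) \<and> (\<forall>i<m. \<forall>j<n. (\<lambda>\<omega>. A \<omega> $$ (i, j)) \<in> borel_measurable M)"

lemma measurable_vec_carrier: "measurable_vec M n F \<Longrightarrow> F \<omega> \<in> carrier_vec n"
  by (simp add: measurable_vec_def)

lemma measurable_vec_dim: "measurable_vec M n F \<Longrightarrow> dim_vec (F \<omega>) = n"
  by (metis carrier_vecD measurable_vec_carrier)

lemma measurable_mat_carrier: "measurable_mat M m n A \<Longrightarrow> A \<omega> \<in> carrier_mat m n"
  by (simp add: measurable_mat_def)

lemma measurable_mat_dim:
  assumes "measurable_mat M m n A"
  shows "dim_row (A \<omega>) = m" "dim_col (A \<omega>) = n"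
  using measurable_mat_carrier[OF assms, of \<omega>] by auto

lemma measurable_vecI:
  assumes "\<And>\<omega>. dim_vec (F \<omega>) = n" "\<And>i. i < n \<Longrightarrow> (\<lambda>\<omega>. F \<omega> $ i) \<in> borel_measurable M"
  shows "measurable_vec M n F"
  using assms by (auto simp: measurable_vec_def intro: carrier_vecI)

lemma measurable_matI:
  assumes "\<And>\<omega>. dim_row (A \<omega>) = m" "\<And>\<omega>. dim_col (A \<omega>) = n"
    and "\<And>i j. i < m \<Longrightarrow> j < n \<Longrightarrow> (\<lambda>\<omega>. A \<omega> $$ (i, j)) \<in> borel_measurable M"
  shows "measurable_mat M m n A"
  using assms by (auto simp: measurable_mat_def intro: carrier_matI)

lemma measurable_vec_index: "measurable_vec M n F \<Longrightarrow> i < n \<Longrightarrow> (\<lambda>\<omega>. F \<omega> $ i) \<in> borel_measurable M"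
  by (simp add: measurable_vec_def)

lemma measurable_mat_index:
  "measurable_mat M m n A \<Longrightarrow> i < m \<Longrightarrow> j < n \<Longrightarrow> (\<lambda>\<omega>. A \<omega> $$ (i, j)) \<in> borel_measurable M"
  by (simp add: measurable_mat_def)

lemma measurable_vec_vec:
  "(\<And>i. i < n \<Longrightarrow> X i \<in> borel_measurable M) \<Longrightarrow> measurable_vec M n (\<lambda>\<omega>. vec n (\<lambda>i. X i \<omega>))"
  by (rule measurable_vecI) auto

lemma measurable_vec_smult:
  assumes "c \<in> borel_measurable M" "measurable_vec M n F"
  shows "measurable_vec M n (\<lambda>\<omega>. c \<omega> \<cdot>\<^sub>v F \<omega>)"
  using assms
  by (intro measurable_vecI) (auto simp: measurable_vec_dim measurable_vec_index intro!: borel_measurable_times)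

lemma measurable_vec_add:
  assumes "measurable_vec M n F" "measurable_vec M n G"
  shows "measurable_vec M n (\<lambda>\<omega>. F \<omega> + G \<omega>)"
  using assms
  by (intro measurable_vecI) (auto simp: measurable_vec_dim measurable_vec_index intro!: borel_measurable_add)

lemma measurable_vec_map:
  assumes q: "q \<in> borel_measurable borel" and F: "measurable_vec M n F"
  shows "measurable_vec M n (\<lambda>\<omega>. map_vec q (F \<omega>))"
proof (rule measurable_vecI)
  fix i
  assume "i < n"
  with F have "(\<lambda>\<omega>. q (F \<omega> $ i)) \<in> borel_measurable M"
    by (intro measurable_compose[OF measurable_vec_index q])
  with F \<open>i < n\<close> show "(\<lambda>\<omega>. map_vec q (F \<omega>) $ i) \<in> borel_measurable M"
    by (simp add: measurable_vec_dim)
qed (use F in \<open>simp add: measurable_vec_dim\<close>)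

lemma measurable_vec_vtail:
  assumes "measurable_vec M n F"
  shows "measurable_vec M (n - 1) (\<lambda>\<omega>. vtail (F \<omega>))"
  using assms by (intro measurable_vecI) (auto simp: vtail_def measurable_vec_dim intro: measurable_vec_index)

lemma measurable_mat_tail_cols:
  assumes "measurable_mat M m n A"
  shows "measurable_mat M m (n - 1) (\<lambda>\<omega>. tail_cols (A \<omega>))"
  using assms by (intro measurable_matI) (auto simp: tail_cols_def measurable_mat_dim intro: measurable_mat_index)

lemma measurable_mat_adjoint:
  assumes "measurable_mat M m n A"
  shows "measurable_mat M n m (\<lambda>\<omega>. mat_adjoint (A \<omega>))"
proof (rule measurable_matI)
  fix i j
  assume "i < n" "j < m"
  then have "(\<lambda>\<omega>. mat_adjoint (A \<omega>) $$ (i, j)) = (\<lambda>\<omega>. cnj (A \<omega> $$ (j, i)))"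
    using assms by (auto simp: mat_adjoint_def mat_of_rows_def measurable_mat_dim)
  then show "(\<lambda>\<omega>. mat_adjoint (A \<omega>) $$ (i, j)) \<in> borel_measurable M"
    using measurable_mat_index[OF assms \<open>j < m\<close> \<open>i < n\<close>] by (simp add: borel_measurable_cnj)
qed (use assms in \<open>auto simp: mat_adjoint_def mat_of_rows_def measurable_mat_dim\<close>)

lemma measurable_mat_transpose:
  assumes "measurable_mat M m n A"
  shows "measurable_mat M n m (\<lambda>\<omega>. transpose_mat (A \<omega>))"
  using assms by (intro measurable_matI) (auto simp: measurable_mat_dim intro: measurable_mat_index)

lemma measurable_mat_rect_diag:
  assumes "\<And>i. i < m \<Longrightarrow> x i \<in> borel_measurable M"
  shows "measurable_mat M m n (\<lambda>\<omega>. rect_diag m n (\<lambda>i. x i \<omega>))"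
  using assms by (intro measurable_matI) (auto simp: rect_diag_def)

lemma measurable_vec_mult_mat:
  assumes "measurable_mat M m n A" "measurable_vec M n F"
  shows "measurable_vec M m (\<lambda>\<omega>. A \<omega> *\<^sub>v F \<omega>)"
proof (rule measurable_vecI)
  fix i
  assume "i < m"
  then have "(\<lambda>\<omega>. (A \<omega> *\<^sub>v F \<omega>) $ i) = (\<lambda>\<omega>. \<Sum>j\<in>{0..<n}. A \<omega> $$ (i, j) * F \<omega> $ j)"
    using assms by (auto simp: scalar_prod_def measurable_mat_dim measurable_vec_dim intro!: sum.cong)
  also have "\<dots> \<in> borel_measurable M"
    using assms \<open>i < m\<close>
    by (intro borel_measurable_sum borel_measurable_times measurable_vec_index measurable_mat_index) auto
  finally show "(\<lambda>\<omega>. (A \<omega> *\<^sub>v F \<omega>) $ i) \<in> borel_measurable M" .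
qed (use assms in \<open>simp add: measurable_mat_dim\<close>)

lemma borel_measurable_vnorm:
  assumes "measurable_vec M n F"
  shows "(\<lambda>\<omega>. vnorm (F \<omega>)) \<in> borel_measurable M"
proof -
  have [measurable]: "(\<lambda>\<omega>. F \<omega> $ i) \<in> borel_measurable M" if "i < n" for i
    using assms that by (rule measurable_vec_index)
  show ?thesis
    unfolding vnorm_def measurable_vec_dim[OF assms] by measurable
qed

lemma borel_measurable_cscalar_prod:
  assumes "measurable_vec M n F" "measurable_vec M n G"
  shows "(\<lambda>\<omega>. F \<omega> \<bullet>c G \<omega>) \<in> borel_measurable M"
proof -
  have [measurable]: "(\<lambda>\<omega>. F \<omega> $ i) \<in> borel_measurable M" "(\<lambda>\<omega>. G \<omega> $ i) \<in> borel_measurable M"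
    if "i < n" for i
    using assms that by (auto intro: measurable_vec_index)
  have "(\<lambda>\<omega>. F \<omega> \<bullet>c G \<omega>) = (\<lambda>\<omega>. \<Sum>i<n. F \<omega> $ i * cnj (G \<omega> $ i))"
    using assms by (auto simp: scalar_prod_def measurable_vec_dim atLeast0LessThan intro!: sum.cong)
  also have "\<dots> \<in> borel_measurable M"
    by measurable
  finally show ?thesis .
qed

text \<open>\<open>householder\<close> gives measurability of \<open>R\<close> as a function of the
  tuple of entries, which is composed here with the measurable map from \<omega> to that
  tuple.\<close>

lemma measurable_mat_householder:
  assumes R: "householder R" and F: "measurable_vec M n F"
  shows "measurable_mat M n n (\<lambda>\<omega>. R (F \<omega>))"
proof -
  have "R (F \<omega>) \<in> carrier_mat n n" for \<omega>
    using R measurable_vec_carrier[OF F] by (auto simp: householder_def unitary_def)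
  moreover have "(\<lambda>\<omega>. R (F \<omega>) $$ (i, j)) \<in> borel_measurable M" if "i < n" "j < n" for i j
  proof -
    have "(\<lambda>x. R (vec n x) $$ (i, j)) \<in> borel_measurable (Pi\<^sub>M {..<n} (\<lambda>_. borel))"
      using R that by (simp add: householder_def)
    moreover have "(\<lambda>\<omega>. \<lambda>i\<in>{..<n}. F \<omega> $ i) \<in> measurable M (Pi\<^sub>M {..<n} (\<lambda>_. borel))"
      using F by (intro measurable_restrict) (auto intro: measurable_vec_index)
    ultimately have "(\<lambda>\<omega>. R (vec n (\<lambda>i\<in>{..<n}. F \<omega> $ i)) $$ (i, j)) \<in> borel_measurable M"
      by (rule measurable_compose[rotated])
    moreover have "vec n (\<lambda>i\<in>{..<n}. F \<omega> $ i) = F \<omega>" for \<omega>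
      using F by (intro eq_vecI) (auto simp: measurable_vec_dim)
    ultimately show ?thesis
      by simp
  qed
  ultimately show ?thesis
    by (simp add: measurable_mat_def)
qed

text \<open>A left inverse of a square matrix is also a right inverse, and inverses are unique. The
  entries of the inverse are thus conjugated entries of \<open>U\<close>, which settles their
  measurability.\<close>

lemma mat_inverse_unitary:
  assumes "unitary n U"
  shows "the (mat_inverse U) = mat_adjoint U"
proof -
  have U: "U \<in> carrier_mat n n" and left: "mat_adjoint U * U = 1\<^sub>m n"
    using assms by (auto simp: unitary_def)
  then have adj: "mat_adjoint U \<in> carrier_mat n n"
    by (simp add: mat_adjoint_def mat_of_rows_def)
  have right: "U * mat_adjoint U = 1\<^sub>m n"
    using mat_mult_left_right_inverse[OF adj U left] .
  show ?thesis
  proof (cases "mat_inverse U")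
    case None
    have "U \<in> Units (ring_mat TYPE(complex) n ())"
      using U adj left right by (auto simp: Units_def ring_mat_def)
    with mat_inverse(1)[OF U None, of "()"] show ?thesis
      by blast
  next
    case (Some B)
    with mat_inverse(2)[OF U] have B: "U * B = 1\<^sub>m n" "B \<in> carrier_mat n n"
      by auto
    have "mat_adjoint U = mat_adjoint U * (U * B)"
      using adj B by simp
    also have "\<dots> = B"
      using adj U B left assoc_mult_mat[of "mat_adjoint U" n n U n B n] by simp
    finally show ?thesis
      using Some by simp
  qed
qed

lemma measurable_vec_rotated:
  assumes "householder R" "measurable_vec M n F" "measurable_vec M n G"
  shows "measurable_vec M n (\<lambda>\<omega>. rotated R (F \<omega>) (G \<omega>))"
proof -
  have "rotated R (F \<omega>) (G \<omega>) = mat_adjoint (R (F \<omega>)) *\<^sub>v G \<omega>" for \<omega>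
    using assms(1) measurable_vec_carrier[OF assms(2)]
    by (simp add: rotated_def mat_inverse_unitary[of n] householder_def)
  then show ?thesis
    using measurable_vec_mult_mat[OF measurable_mat_adjoint[OF measurable_mat_householder[OF assms(1,2)]] assms(3)]
    by simp
qed

section \<open>Measurability of \<open>T_s\<close> and \<open>T_g\<close>\<close>

context
  fixes R :: "complex vec \<Rightarrow> complex mat" and q :: "complex \<Rightarrow> complex"
    and M :: "'w measure" and K N :: nat
    and D fD :: "'w \<Rightarrow> complex mat" and s g1 g2 z1 z2 :: "'w \<Rightarrow> complex vec"
  assumes R: "householder R" and q: "q \<in> borel_measurable borel"
    and D: "measurable_mat M K N D" and fD: "measurable_mat M K N fD"
    and s: "measurable_vec M K s" and g1: "measurable_vec M K g1" and g2: "measurable_vec M K g2"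
    and z1: "measurable_vec M N z1" and z2: "measurable_vec M N z2"
begin

text \<open>Division is total with value 0 at a zero denominator, and the quotient of measurable
  functions stays measurable where a norm vanishes.\<close>

lemma measurable_vec_s1_hat: "measurable_vec M N (\<lambda>\<omega>. s1_hat (fD \<omega>) (s \<omega>) (g1 \<omega>))"
  unfolding s1_hat_def
  using measurable_vec_mult_mat[OF measurable_mat_transpose[OF fD] g1]
    borel_measurable_vnorm[OF s] borel_measurable_vnorm[OF g1]
  by (intro measurable_vec_smult borel_measurable_complex_of_real borel_measurable_divide)

lemma measurable_vec_quantized:
  "measurable_vec M N (\<lambda>\<omega>. quantized q (s1_hat (fD \<omega>) (s \<omega>) (g1 \<omega>)) (z1 \<omega>))"
  unfolding quantized_def
  using borel_measurable_vnorm[OF measurable_vec_s1_hat] borel_measurable_vnorm[OF z1]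
  by (intro measurable_vec_map q measurable_vec_smult z1 borel_measurable_complex_of_real
      borel_measurable_divide)

lemma measurable_vec_W_hat:
  "measurable_vec M K (\<lambda>\<omega>. W_hat R q (D \<omega>) (fD \<omega>) (s \<omega>) (g1 \<omega>) (z1 \<omega>) (z2 \<omega>))"
  unfolding W_hat_def Let_def C1_hat_def C2_hat_def
  using borel_measurable_cscalar_prod[OF measurable_vec_quantized z1]
    borel_measurable_vnorm[OF measurable_vec_s1_hat] borel_measurable_vnorm[OF z1]
    borel_measurable_vnorm[OF measurable_vec_vtail[OF z2]]
    borel_measurable_vnorm[OF measurable_vec_mult_mat[OF measurable_mat_adjoint[OF
          measurable_mat_tail_cols[OF measurable_mat_householder[OF R z1]]] measurable_vec_quantized]]
    measurable_vec_mult_mat[OF D measurable_vec_s1_hat]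
    measurable_vec_mult_mat[OF D measurable_vec_mult_mat[OF
          measurable_mat_tail_cols[OF measurable_mat_householder[OF R measurable_vec_s1_hat]]
          measurable_vec_vtail[OF z2]]]
  by (intro measurable_vec_add measurable_vec_smult
      borel_measurable_divide borel_measurable_complex_of_real borel_measurable_times)

lemma borel_measurable_T_g:
  "(\<lambda>\<omega>. T_g R q (D \<omega>) (fD \<omega>) (s \<omega>) (g1 \<omega>) (g2 \<omega>) (z1 \<omega>) (z2 \<omega>)) \<in> borel_measurable M"
  unfolding T_g_def
  by (rule borel_measurable_divide[OF
        borel_measurable_vnorm[OF measurable_vec_mult_mat[OF measurable_mat_adjoint[OF
              measurable_mat_tail_cols[OF measurable_mat_householder[OF R g1]]] measurable_vec_W_hat]]
        borel_measurable_vnorm[OF measurable_vec_vtail[OF measurable_vec_rotated[OF R s g2]]]])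

lemma borel_measurable_T_s:
  assumes "0 < K"
  shows "(\<lambda>\<omega>. T_s R q (D \<omega>) (fD \<omega>) (s \<omega>) (g1 \<omega>) (g2 \<omega>) (z1 \<omega>) (z2 \<omega>)) \<in> borel_measurable M"
  unfolding T_s_def
  using borel_measurable_cscalar_prod[OF measurable_vec_W_hat g1] borel_measurable_vnorm[OF g1]
    borel_measurable_vnorm[OF s] borel_measurable_T_g
    measurable_vec_index[OF measurable_vec_rotated[OF R s g2] assms]
  by (intro borel_measurable_divide borel_measurable_diff borel_measurable_times
      borel_measurable_complex_of_real)

end

section \<open>Comparison of the error probabilities\<close>

text \<open>No probability reaches 2. Nonemptiness gives the infimum in \<open>dKF\<close> its
  meaning.\<close>

lemma dKF_set_nonempty:
  assumes "prob_space P"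
  shows "2 \<in> {\<delta>. \<delta> > 0 \<and> measure P {\<omega> \<in> space P. cmod (X \<omega> - Y \<omega>) > \<delta>} < \<delta>}"
proof -
  interpret prob_space P by fact
  have "prob A < 2" for A
    by (rule le_less_trans[OF prob_le_1]) simp
  then show ?thesis
    by simp
qed

lemma dKF_nonneg:
  assumes "prob_space P"
  shows "0 \<le> dKF P X Y"
  unfolding dKF_def using dKF_set_nonempty[OF assms, of X Y] by (intro cInf_greatest) (blast, simp)

text \<open>Some admissible \<epsilon> lies strictly below \<delta>, and the tail probability
  decreases in the threshold. This monotonicity is where measurability enters.\<close>

lemma prob_gt_dKF:
  assumes "prob_space P" and [measurable]: "X \<in> borel_measurable P" "Y \<in> borel_measurable P"
    and less: "dKF P X Y < \<delta>"
  shows "measure P {\<omega> \<in> space P. cmod (X \<omega> - Y \<omega>) > \<delta>} < \<delta>"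
proof -
  interpret prob_space P by fact
  let ?D = "{\<delta>. \<delta> > 0 \<and> measure P {\<omega> \<in> space P. cmod (X \<omega> - Y \<omega>) > \<delta>} < \<delta>}"
  have "2 \<in> ?D"
    using dKF_set_nonempty[OF assms(1)] .
  then obtain \<epsilon> where \<epsilon>: "\<epsilon> \<in> ?D" "\<epsilon> < \<delta>"
    using less cInf_lessD[of ?D \<delta>] unfolding dKF_def by blast
  have "measure P {\<omega> \<in> space P. cmod (X \<omega> - Y \<omega>) > \<delta>} \<le> measure P {\<omega> \<in> space P. cmod (X \<omega> - Y \<omega>) > \<epsilon>}"
    using \<epsilon> by (intro finite_measure_mono) auto
  with \<epsilon> show ?thesis
    by auto
qed

section \<open>The constants \<open>L_const\<close>\<close>

text \<open>The natural constant is \<open>4 / sqrt (pi * v)\<close>. It is below \<open>sqrt pi / v + 1\<close> for every \<open>v\<close>, because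
  \<open>x \<mapsto> sqrt pi * x\<^sup>2 - 4 / sqrt pi * x + 1\<close> has no real root.\<close>

lemma shell_const_le:
  assumes "0 < v"
  shows "4 / sqrt (pi * v) \<le> sqrt pi / v + 1"
proof -
  \<comment> \<open>With \<open>p\<close> the fourth root of \<open>pi\<close> the claim reads
    \<open>4 / p\<^sup>2 * x \<le> (p * x)\<^sup>2 + 1\<close>. It follows from
    \<open>4 / p\<^sup>2 \<le> 2 * p\<close> and
    \<open>2 * (p * x) \<le> (p * x)\<^sup>2 + 1\<close>; the former amounts to
    \<open>16 \<le> pi ^ 3\<close>.\<close>
  define p x where "p = sqrt (sqrt pi)" and "x = 1 / sqrt v"
  have p: "p\<^sup>2 = sqrt pi" and "0 < p"
    by (auto simp: p_def)
  have x: "x\<^sup>2 = 1 / v" "0 < x"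
    using assms by (auto simp: x_def power_divide)
  have "4 / sqrt (pi * v) = 4 / p\<^sup>2 * x"
    unfolding p x_def by (simp add: real_sqrt_mult)
  also have "\<dots> \<le> 2 * p * x"
  proof (rule mult_right_mono)
    have "(2::real) ^ 4 \<le> pi ^ 3"
      using power_mono[of 3 pi 3] pi_gt3 by simp
    also have "pi = p ^ 4"
    proof -
      have "p ^ 4 = (p\<^sup>2)\<^sup>2" by simp
      then show ?thesis by (simp add: p)
    qed
    finally have "2 ^ 4 \<le> (p ^ 3) ^ 4"
      by (simp flip: power_mult)
    then have "2 \<le> p ^ 3"
      using \<open>0 < p\<close> power_mono_iff[of 2 "p ^ 3" 4] by simp
    then show "4 / p\<^sup>2 \<le> 2 * p"
      using \<open>0 < p\<close> by (simp add: divide_simps power3_eq_cube power2_eq_square)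
  qed (use x in simp)
  also have "\<dots> \<le> (p * x)\<^sup>2 + 1"
    using sum_squares_bound[of "p * x" 1] by simp
  also have "\<dots> = sqrt pi / v + 1"
    by (simp add: power_mult_distrib p x)
  finally show ?thesis .
qed

text \<open>On the left, \<open>\<delta>\<^sub>1 + \<delta>\<^sub>2\<close> pays for the exceptional
  event and the fraction for the shell. The shell is measured before multiplication by \<beta>,
  whereas \<open>eff_var\<close> is the variance after it; the square root turns this into the
  factor \<open>cmod \<beta>\<close> in the maximum.\<close>

lemma L_const_lower:
  assumes "\<beta> \<noteq> 0" "0 < \<eta>" "0 < (\<eta> * Tg)\<^sup>2 + \<sigma>\<^sup>2" "0 \<le> \<delta>\<^sub>1" "0 \<le> \<delta>\<^sub>2"
  shows "\<delta>\<^sub>1 + \<delta>\<^sub>2 + 4 * (\<eta> * (cmod z * \<delta>\<^sub>1 + \<delta>\<^sub>2)) / sqrt (pi * ((\<eta> * Tg)\<^sup>2 + \<sigma>\<^sup>2))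
    \<le> L_const \<beta> \<eta> \<sigma> Tg z * (\<delta>\<^sub>1 + \<delta>\<^sub>2)"
proof -
  define v where "v = eff_var \<beta> \<eta> \<sigma> Tg"
  define b where "b = cmod \<beta>"
  have b: "0 < b" and v_eq: "v = b\<^sup>2 * ((\<eta> * Tg)\<^sup>2 + \<sigma>\<^sup>2)"
    using assms by (auto simp: b_def v_def eff_var_def norm_mult power_mult_distrib algebra_simps)
  have v: "0 < v"
    using assms b by (simp add: v_eq)
  have "sqrt (pi * v) = b * sqrt (pi * ((\<eta> * Tg)\<^sup>2 + \<sigma>\<^sup>2))"
    using b by (simp add: v_eq real_sqrt_mult)
  then have "4 * (\<eta> * (cmod z * \<delta>\<^sub>1 + \<delta>\<^sub>2)) / sqrt (pi * ((\<eta> * Tg)\<^sup>2 + \<sigma>\<^sup>2))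
      = 4 / sqrt (pi * v) * (b * \<eta> * (cmod z * \<delta>\<^sub>1 + \<delta>\<^sub>2))"
    using b by simp
  also have "\<dots> \<le> (sqrt pi / v + 1) * (b * \<eta> * (cmod z * \<delta>\<^sub>1 + \<delta>\<^sub>2))"
    using assms b by (intro mult_right_mono shell_const_le v) auto
  finally have "\<delta>\<^sub>1 + \<delta>\<^sub>2 + 4 * (\<eta> * (cmod z * \<delta>\<^sub>1 + \<delta>\<^sub>2)) / sqrt (pi * ((\<eta> * Tg)\<^sup>2 + \<sigma>\<^sup>2))
      \<le> 1 * (\<delta>\<^sub>1 + \<delta>\<^sub>2) + (sqrt pi / v + 1) * (b * \<eta> * (cmod z * \<delta>\<^sub>1 + \<delta>\<^sub>2))"
    by simp
  \<comment> \<open>The summand 1 in the first factor of \<open>L_const\<close> lets the exceptional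
    event carry that factor too; it then supplies the summands 1 in the maximum.\<close>
  also have "\<dots> \<le> (sqrt pi / v + 1) * (\<delta>\<^sub>1 + \<delta>\<^sub>2) + (sqrt pi / v + 1) * (b * \<eta> * (cmod z * \<delta>\<^sub>1 + \<delta>\<^sub>2))"
    using assms v by (intro add_right_mono mult_right_mono) auto
  also have "\<dots> = (sqrt pi / v + 1) * ((b * \<eta> * cmod z + 1) * \<delta>\<^sub>1 + (b * \<eta> + 1) * \<delta>\<^sub>2)"
    by (simp add: algebra_simps add_divide_distrib)
  also have "\<dots> \<le> (sqrt pi / v + 1) * (max (b * \<eta> * cmod z + 1) (b * \<eta> + 1) * \<delta>\<^sub>1
      + max (b * \<eta> * cmod z + 1) (b * \<eta> + 1) * \<delta>\<^sub>2)"
    using assms v by (intro mult_left_mono add_mono mult_right_mono) auto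
  also have "\<dots> = L_const \<beta> \<eta> \<sigma> Tg z * (\<delta>\<^sub>1 + \<delta>\<^sub>2)"
    by (simp add: L_const_def v_def b_def distrib_left)
  finally show ?thesis .
qed

section \<open>From shells to error probabilities\<close>

lemma measure_uniform_on:
  assumes "finite S" "S \<noteq> {}" "A \<in> sets borel"
  shows "measure (uniform_on S) A = real (card (S \<inter> A)) / real (card S)"
  using assms by (simp add: uniform_on_def measure_distr measure_pmf_of_set)

text \<open>Nothing but measurability and closeness off \<open>bad\<close> is asked of
  \<open>y'\<close>, which may depend on \<open>s\<close> and \<open>w\<close>. Each difference of
  the two error events is covered by \<open>bad\<close>, a null event and, for each symbol, a shell
  event for \<open>w\<close>.\<close>

lemma SEP_diff_le:
  assumes P: "prob_space P" and S: "finite S" "S \<noteq> {}" and dec: "nearest_point_map S dec"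
    and "\<beta> \<noteq> 0" and v: "0 < v"
    and indep: "prob_space.indep_var P borel s borel w"
    and s_law: "distr P borel s = uniform_on S"
    and w_law: "distr P borel w = density lborel (\<lambda>x. ennreal (cn_density v x))"
    and y' [measurable]: "y' \<in> borel_measurable P"
    and bad: "bad \<in> sets P" "measure P bad \<le> \<delta>"
    and close: "\<And>\<omega>. \<omega> \<in> space P \<Longrightarrow> \<omega> \<notin> bad \<Longrightarrow> cmod (y' \<omega> - (m * s \<omega> + w \<omega>)) \<le> \<epsilon> (s \<omega>)"
    and \<epsilon>: "\<And>z. z \<in> S \<Longrightarrow> 0 \<le> \<epsilon> z"
  shows "\<bar>SEP P dec \<beta> y' s - SEP P dec \<beta> (\<lambda>\<omega>. m * s \<omega> + w \<omega>) s\<bar>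
    \<le> \<delta> + 1 / real (card S) * (\<Sum>z\<in>S. 4 * \<epsilon> z / sqrt (pi * v))"
proof -
  interpret prob_space P by fact
  have [measurable]: "s \<in> borel_measurable P" "w \<in> borel_measurable P"
    using indep_var_rv1[OF indep] indep_var_rv2[OF indep] by auto
  have [measurable]: "dec \<in> borel_measurable borel"
    using dec by (simp add: nearest_point_map_def)
  have [measurable]: "bad \<in> sets P"
    by fact
  let ?err = "\<lambda>y. {\<omega> \<in> space P. dec (\<beta> * y \<omega>) \<noteq> s \<omega>}"
  let ?y = "\<lambda>\<omega>. m * s \<omega> + w \<omega>"
  have s_prob: "prob {\<omega> \<in> space P. s \<omega> \<in> A} = real (card (S \<inter> A)) / real (card S)"
    if "A \<in> sets borel" for A
  proof -
    have "prob {\<omega> \<in> space P. s \<omega> \<in> A} = measure (distr P borel s) A"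
      using that by (subst measure_distr) (auto simp: vimage_def Int_def conj_commute)
    then show ?thesis
      using S that by (simp add: s_law measure_uniform_on)
  qed
  have w_prob: "prob {\<omega> \<in> space P. w \<omega> \<in> cell_shell S \<beta> m' z t (\<epsilon> z)} \<le> 4 * \<epsilon> z / sqrt (pi * v)"
    if "z \<in> S" for z t m'
  proof -
    let ?A = "cell_shell S \<beta> m' z t (\<epsilon> z)"
    have [measurable]: "?A \<in> sets borel"
      using S by (intro sets_cell_shell)
    have "ennreal (prob {\<omega> \<in> space P. w \<omega> \<in> ?A}) = emeasure (distr P borel w) ?A"
      by (subst emeasure_distr) (auto simp: emeasure_eq_measure vimage_def Int_def conj_commute)
    also have "\<dots> \<le> ennreal (4 * \<epsilon> z / sqrt (pi * v))"
      unfolding w_law using S assms that by (intro emeasure_cell_shell) auto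
    finally show ?thesis
      using \<epsilon>[OF that] v by (subst (asm) ennreal_le_iff) auto
  qed
  have diff: "prob (E - E') \<le> \<delta> + 1 / real (card S) * (\<Sum>z\<in>S. 4 * \<epsilon> z / sqrt (pi * v))"
    if E: "E \<in> events" "E' \<in> events"
      and sub: "\<And>\<omega>. \<omega> \<in> E \<Longrightarrow> \<omega> \<notin> E' \<Longrightarrow> \<omega> \<notin> bad \<Longrightarrow> w \<omega> \<in> cell_shell S \<beta> (m * s \<omega>) (s \<omega>) (t (s \<omega>)) (\<epsilon> (s \<omega>))"
    for E E' and t :: "complex \<Rightarrow> real"
  proof -
    let ?B = "\<lambda>z. {\<omega> \<in> space P. w \<omega> \<in> cell_shell S \<beta> (m * z) z (t z) (\<epsilon> z)}"
    let ?s = "\<lambda>z. {\<omega> \<in> space P. s \<omega> \<in> {z}}"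
    have [measurable]: "cell_shell S \<beta> (m * z) z (t z) (\<epsilon> z) \<in> sets borel" for z
      using S by (intro sets_cell_shell)
    \<comment> \<open>\<open>s\<close> takes values in \<open>S\<close> only almost surely; the
      exceptional event is measurable since a finite set is closed, and null by the law of
      \<open>s\<close>.\<close>
    have "- S \<in> sets borel"
      using S by (simp add: borel_closed finite_imp_closed borel_comp)
    then have meas: "{\<omega> \<in> space P. s \<omega> \<in> - S} \<in> events"
      by measurable
    have sB: "?s z \<inter> ?B z \<in> events" for z
      by measurable
    have "prob (E - E') \<le> prob ((bad \<union> {\<omega> \<in> space P. s \<omega> \<in> - S}) \<union> (\<Union>z\<in>S. ?s z \<inter> ?B z))"
    proof (rule finite_measure_mono)
      show "E - E' \<subseteq> (bad \<union> {\<omega> \<in> space P. s \<omega> \<in> - S}) \<union> (\<Union>z\<in>S. ?s z \<inter> ?B z)"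
        using sub E(1)[THEN sets.sets_into_space] by force
      show "(bad \<union> {\<omega> \<in> space P. s \<omega> \<in> - S}) \<union> (\<Union>z\<in>S. ?s z \<inter> ?B z) \<in> events"
        using S meas bad sB by (intro sets.Un sets.finite_UN)
    qed
    also have "\<dots> \<le> prob (bad \<union> {\<omega> \<in> space P. s \<omega> \<in> - S}) + prob (\<Union>z\<in>S. ?s z \<inter> ?B z)"
      using S meas bad sB by (intro measure_Un_le sets.Un sets.finite_UN)
    also have "\<dots> \<le> (prob bad + prob {\<omega> \<in> space P. s \<omega> \<in> - S}) + (\<Sum>z\<in>S. prob (?s z \<inter> ?B z))"
      using S meas bad sB
      by (intro add_mono measure_Un_le measure_UNION_le) auto
    also have "prob {\<omega> \<in> space P. s \<omega> \<in> - S} = 0"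
      using s_prob[OF \<open>- S \<in> sets borel\<close>] by simp
    also have "(\<Sum>z\<in>S. prob (?s z \<inter> ?B z)) \<le> (\<Sum>z\<in>S. 1 / real (card S) * (4 * \<epsilon> z / sqrt (pi * v)))"
    proof (rule sum_mono)
      fix z
      assume "z \<in> S"
      \<comment> \<open>Once the symbol is fixed at \<open>z\<close> the shell is a deterministic
        set, so independence of \<open>s\<close> and \<open>w\<close> applies.\<close>
      have "prob (?s z \<inter> ?B z) = prob (?s z) * prob (?B z)"
        using indep_varD[OF indep, of "{z}" "cell_shell S \<beta> (m * z) z (t z) (\<epsilon> z)"]
        by (auto simp: vimage_def Int_def conj_ac intro!: arg_cong2[where f = "(*)"] arg_cong[where f = prob] elim!: trans[rotated])
      also have "prob (?s z) = 1 / real (card S)"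
        using s_prob[of "{z}"] \<open>z \<in> S\<close> by simp
      also have "1 / real (card S) * prob (?B z) \<le> 1 / real (card S) * (4 * \<epsilon> z / sqrt (pi * v))"
        using \<open>z \<in> S\<close> by (intro mult_left_mono w_prob) auto
      finally show "prob (?s z \<inter> ?B z) \<le> 1 / real (card S) * (4 * \<epsilon> z / sqrt (pi * v))" .
    qed
    also have "\<dots> = 1 / real (card S) * (\<Sum>z\<in>S. 4 * \<epsilon> z / sqrt (pi * v))"
      by (simp only: sum_distrib_left)
    finally show ?thesis
      using bad by simp
  qed
  have le: "prob E \<le> prob E' + prob (E - E')" if "E \<in> events" "E' \<in> events" for E E'
    using finite_measure_mono[of E "E' \<union> (E - E')"] measure_Un_le[of E' P "E - E'"] that
    by auto
  have E: "?err y' \<in> events" "?err ?y \<in> events"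
    by measurable
  \<comment> \<open>If only \<open>y'\<close> is decoded wrongly, \<open>m * s + w\<close> lies in
    the inner shell, with offset \<open>- \<epsilon> z\<close>; the converse case below uses the
    outer shell, with offset 0.\<close>
  have "prob (?err y' - ?err ?y) \<le> \<delta> + 1 / real (card S) * (\<Sum>z\<in>S. 4 * \<epsilon> z / sqrt (pi * v))"
    using close dec \<open>\<beta> \<noteq> 0\<close>
    by (intro diff[OF E, of "\<lambda>z. - \<epsilon> z"] cell_shell_inner[of S dec \<beta> "y' \<omega>" for \<omega>]) auto
  moreover have "prob (?err ?y - ?err y') \<le> \<delta> + 1 / real (card S) * (\<Sum>z\<in>S. 4 * \<epsilon> z / sqrt (pi * v))"
    using close dec \<open>\<beta> \<noteq> 0\<close>
    by (intro diff[OF E(2,1), of "\<lambda>z. 0"] cell_shell_outer[of S dec \<beta> "y' \<omega>" for \<omega>]) auto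
  ultimately show ?thesis
    unfolding SEP_def using le[OF E] le[OF E(2,1)] by linarith
qed

text \<open>Entries are coordinates of independent blocks. Grouping the blocks \<open>b\<close> and
  \<open>c\<close> against \<open>a\<close> makes a symbol independent of a combination of
  \<open>g2\<close> and the noise; the second claim makes the two Gaussian terms independent of each
  other.\<close>

lemma indep_vectors_entries:
  assumes P: "prob_space P" and ind: "indep_vectors P Xs"
    and abc: "a < length Xs" "b < length Xs" "c < length Xs" "a \<noteq> b" "a \<noteq> c" "b \<noteq> c"
    and ijk: "i < fst (Xs ! a)" "j < fst (Xs ! b)" "k < fst (Xs ! c)"
  shows "h \<in> borel_measurable (borel \<Otimes>\<^sub>M borel) \<Longrightarrow>
      prob_space.indep_var P borel (snd (Xs ! a) i) borel (\<lambda>\<omega>. h (snd (Xs ! b) j \<omega>, snd (Xs ! c) k \<omega>) :: complex)"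
    and "prob_space.indep_var P borel (snd (Xs ! b) j) borel (snd (Xs ! c) k)"
proof -
  interpret prob_space P by fact
  define M' :: "nat \<Rightarrow> (nat \<Rightarrow> complex) measure" where "M' = (\<lambda>b. Pi\<^sub>M {..<fst (Xs ! b)} (\<lambda>_. borel))"
  define Y where "Y = (\<lambda>b \<omega>. \<lambda>i\<in>{..<fst (Xs ! b)}. snd (Xs ! b) i \<omega>)"
  have ind: "indep_vars M' Y {..<length Xs}"
    using ind by (simp add: indep_vectors_def M'_def Y_def)
  have entry: "(\<lambda>f. f b j) \<in> measurable (Pi\<^sub>M J M') borel" if "b \<in> J" "j < fst (Xs ! b)" for b j J
    using measurable_compose[OF measurable_component_singleton[OF \<open>b \<in> J\<close>, of M'],
        of "\<lambda>x. x j" borel] that by (simp add: M'_def)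
  show "indep_var borel (snd (Xs ! a) i) borel (\<lambda>\<omega>. h (snd (Xs ! b) j \<omega>, snd (Xs ! c) k \<omega>))"
    if h: "h \<in> borel_measurable (borel \<Otimes>\<^sub>M borel)"
  proof -
    have "indep_var borel ((\<lambda>f. f a i) \<circ> (\<lambda>\<omega>. \<lambda>b\<in>{a}. Y b \<omega>))
        borel ((\<lambda>f. h (f b j, f c k)) \<circ> (\<lambda>\<omega>. \<lambda>b\<in>{b, c}. Y b \<omega>))"
      using abc ijk
      by (intro indep_var_compose[OF indep_var_restrict[OF ind]] measurable_compose[OF measurable_Pair h] entry) auto
    then show ?thesis
      using abc ijk by (simp add: comp_def Y_def cong: if_cong)
  qed
  have "indep_var borel ((\<lambda>f. f b j) \<circ> (\<lambda>\<omega>. \<lambda>b\<in>{b}. Y b \<omega>)) borel ((\<lambda>f. f c k) \<circ> (\<lambda>\<omega>. \<lambda>b\<in>{c}. Y b \<omega>))"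
    using abc ijk by (intro indep_var_compose[OF indep_var_restrict[OF ind]] entry) auto
  then show "indep_var borel (snd (Xs ! b) j) borel (snd (Xs ! c) k)"
    using ijk by (simp add: comp_def Y_def)
qed

text \<open>\<open>Ts\<close> and \<open>Tg\<close> may depend on \<open>s\<close>, \<open>g\<close>
  and \<open>n\<close> in any measurable way: they enter through Ky Fan distances, while laws and
  independence concern only \<open>s\<close>, \<open>g\<close> and \<open>n\<close>.\<close>

lemma SEP_diff_dKF:
  fixes s g n Ts Tg :: "'w \<Rightarrow> complex" and \<eta> \<sigma> t :: real
  assumes P: "prob_space P" and S: "finite S" "S \<noteq> {}" and dec: "nearest_point_map S dec"
    and "\<beta> \<noteq> 0" and "0 < \<eta>" and pos: "0 < (\<eta> * t)\<^sup>2 + \<sigma>\<^sup>2"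
    and indep: "prob_space.indep_var P borel s borel (\<lambda>\<omega>. of_real (\<eta> * t) * g \<omega> + n \<omega>)"
    and indep_gn: "prob_space.indep_var P borel g borel n"
    and s: "distr P borel s = uniform_on S"
    and g: "distr P borel g = CN 1" and n: "distr P borel n = CN (\<sigma>\<^sup>2)"
    and [measurable]: "Ts \<in> borel_measurable P" "Tg \<in> borel_measurable P"
  shows "\<bar>SEP P dec \<beta> (\<lambda>\<omega>. of_real \<eta> * Ts \<omega> * s \<omega> + of_real \<eta> * Tg \<omega> * g \<omega> + n \<omega>) s
      - SEP P dec \<beta> (\<lambda>\<omega>. of_real \<eta> * Ts' * s \<omega> + of_real \<eta> * of_real t * g \<omega> + n \<omega>) s\<bar>
    \<le> 1 / real (card S) * (\<Sum>z\<in>S. L_const \<beta> \<eta> \<sigma> t z *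
        (dKF P Ts (\<lambda>_. Ts') + dKF P (\<lambda>\<omega>. Tg \<omega> * g \<omega>) (\<lambda>\<omega>. of_real t * g \<omega>)))"
    (is "?diff \<le> 1 / real (card S) * (\<Sum>z\<in>S. _ * (?d\<^sub>1 + ?d\<^sub>2))")
proof -
  interpret prob_space P by fact
  have [measurable]: "s \<in> borel_measurable P" "g \<in> borel_measurable P" "n \<in> borel_measurable P"
    using indep_var_rv1[OF indep] indep_var_rv1[OF indep_gn] indep_var_rv2[OF indep_gn] by auto
  define v where "v = (\<eta> * t)\<^sup>2 + \<sigma>\<^sup>2"
  have v: "0 < v"
    using pos by (simp add: v_def)
  have w_law: "distr P borel (\<lambda>\<omega>. of_real (\<eta> * t) * g \<omega> + n \<omega>) = density lborel (\<lambda>x. ennreal (cn_density v x))"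
    unfolding v_def
    by (rule distr_gaussian_combination[OF P indep_gn g n less_imp_neq[OF pos, symmetric]])
  have bound: "?diff \<le> 1 / real (card S) * (\<Sum>z\<in>S. L_const \<beta> \<eta> \<sigma> t z * ((?d\<^sub>1 + e) + (?d\<^sub>2 + e)))"
    if "0 < e" for e
  proof -
    \<comment> \<open>The tail bound is available strictly above the Ky Fan distance, hence the
      slack \<open>e\<close>.\<close>
    define \<delta>\<^sub>1 \<delta>\<^sub>2 where "\<delta>\<^sub>1 = ?d\<^sub>1 + e" and "\<delta>\<^sub>2 = ?d\<^sub>2 + e"
    have \<delta>: "0 \<le> \<delta>\<^sub>1" "0 \<le> \<delta>\<^sub>2"
      using that dKF_nonneg[OF P] by (auto simp: \<delta>\<^sub>1_def \<delta>\<^sub>2_def intro!: add_nonneg_nonneg)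
    define \<epsilon> where "\<epsilon> z = \<eta> * (cmod z * \<delta>\<^sub>1 + \<delta>\<^sub>2)" for z
    define bad\<^sub>1 bad\<^sub>2 where "bad\<^sub>1 = {\<omega> \<in> space P. cmod (Ts \<omega> - Ts') > \<delta>\<^sub>1}"
      and "bad\<^sub>2 = {\<omega> \<in> space P. cmod (Tg \<omega> * g \<omega> - of_real t * g \<omega>) > \<delta>\<^sub>2}"
    have [measurable]: "bad\<^sub>1 \<in> events" "bad\<^sub>2 \<in> events"
      unfolding bad\<^sub>1_def bad\<^sub>2_def by measurable
    have "prob bad\<^sub>1 < \<delta>\<^sub>1" "prob bad\<^sub>2 < \<delta>\<^sub>2"
      unfolding bad\<^sub>1_def bad\<^sub>2_def using that
      by (auto intro!: prob_gt_dKF[OF P] simp: \<delta>\<^sub>1_def \<delta>\<^sub>2_def)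
    then have bad: "prob (bad\<^sub>1 \<union> bad\<^sub>2) \<le> \<delta>\<^sub>1 + \<delta>\<^sub>2"
      using measure_Un_le[of bad\<^sub>1 P bad\<^sub>2] by simp
    have close: "cmod ((of_real \<eta> * Ts \<omega> * s \<omega> + of_real \<eta> * Tg \<omega> * g \<omega> + n \<omega>)
        - (of_real \<eta> * Ts' * s \<omega> + (of_real (\<eta> * t) * g \<omega> + n \<omega>))) \<le> \<epsilon> (s \<omega>)"
      if "\<omega> \<in> space P" "\<omega> \<notin> bad\<^sub>1 \<union> bad\<^sub>2" for \<omega>
    proof -
      \<comment> \<open>The noise cancels, and the rest separates into the two differences
        controlled by the Ky Fan distances, the first weighted by the symbol.\<close>
      have "(of_real \<eta> * Ts \<omega> * s \<omega> + of_real \<eta> * Tg \<omega> * g \<omega> + n \<omega>)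
          - (of_real \<eta> * Ts' * s \<omega> + (of_real (\<eta> * t) * g \<omega> + n \<omega>))
        = of_real \<eta> * (s \<omega> * (Ts \<omega> - Ts') + (Tg \<omega> * g \<omega> - of_real t * g \<omega>))"
        by (simp add: algebra_simps)
      also have "cmod \<dots> \<le> \<eta> * (cmod (s \<omega>) * cmod (Ts \<omega> - Ts') + cmod (Tg \<omega> * g \<omega> - of_real t * g \<omega>))"
        unfolding norm_mult norm_of_real
        using \<open>0 < \<eta>\<close> by (auto intro!: norm_triangle_le simp: norm_mult)
      also have "\<dots> \<le> \<epsilon> (s \<omega>)"
        unfolding \<epsilon>_def using that \<open>0 < \<eta>\<close>
        by (intro mult_left_mono add_mono) (auto simp: bad\<^sub>1_def bad\<^sub>2_def)
      finally show ?thesis .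
    qed
    have "?diff \<le> (\<delta>\<^sub>1 + \<delta>\<^sub>2) + 1 / real (card S) * (\<Sum>z\<in>S. 4 * \<epsilon> z / sqrt (pi * v))"
      using SEP_diff_le[where \<epsilon> = \<epsilon>, OF P S dec \<open>\<beta> \<noteq> 0\<close> v indep s w_law _ _ bad close] \<delta> \<open>0 < \<eta>\<close>
      by (simp add: \<epsilon>_def add.assoc mult.assoc)
    \<comment> \<open>Averaging a constant over the nonempty \<open>S\<close> leaves it unchanged,
      so the exceptional probability can be absorbed symbol by symbol.\<close>
    also have "\<dots> = 1 / real (card S) * (\<Sum>z\<in>S. (\<delta>\<^sub>1 + \<delta>\<^sub>2) + 4 * \<epsilon> z / sqrt (pi * v))"
      using S by (simp add: sum.distrib distrib_left)
    also have "\<dots> \<le> 1 / real (card S) * (\<Sum>z\<in>S. L_const \<beta> \<eta> \<sigma> t z * (\<delta>\<^sub>1 + \<delta>\<^sub>2))"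
      unfolding \<epsilon>_def v_def
      using \<open>\<beta> \<noteq> 0\<close> \<open>0 < \<eta>\<close> pos \<delta> by (intro mult_left_mono sum_mono L_const_lower) auto
    finally show ?thesis
      unfolding \<delta>\<^sub>1_def \<delta>\<^sub>2_def .
  qed
  \<comment> \<open>The bound is affine in \<open>e\<close>; letting \<open>e\<close> decrease to 0
    restores the Ky Fan distances.\<close>
  show ?thesis
  proof (rule tendsto_lowerbound[where F = "at_right (0::real)"])
    show "((\<lambda>e. 1 / real (card S) * (\<Sum>z\<in>S. L_const \<beta> \<eta> \<sigma> t z * ((?d\<^sub>1 + e) + (?d\<^sub>2 + e))))
        \<longlongrightarrow> 1 / real (card S) * (\<Sum>z\<in>S. L_const \<beta> \<eta> \<sigma> t z * (?d\<^sub>1 + ?d\<^sub>2))) (at_right 0)"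
      using S by (auto intro!: tendsto_eq_intros)
    show "\<forall>\<^sub>F e in at_right 0. ?diff \<le> 1 / real (card S) * (\<Sum>z\<in>S. L_const \<beta> \<eta> \<sigma> t z * ((?d\<^sub>1 + e) + (?d\<^sub>2 + e)))"
      using eventually_at_right_less[of "0::real"] by eventually_elim (rule bound)
  qed simp
qed

section \<open>Application to the finite model\<close>

theorem theorem3p1:
  fixes P :: "nat \<Rightarrow> 'w measure"
    and N :: "nat \<Rightarrow> nat"
    and H :: "nat \<Rightarrow> nat \<times> nat \<Rightarrow> 'w \<Rightarrow> complex"
    and d :: "nat \<Rightarrow> nat \<Rightarrow> 'w \<Rightarrow> real"
    and s n g1 g2 z1 z2 :: "nat \<Rightarrow> nat \<Rightarrow> 'w \<Rightarrow> complex"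
    and S X :: "complex set"
    and f :: "real \<Rightarrow> real"
    and q dec :: "complex \<Rightarrow> complex"
    and R :: "complex vec \<Rightarrow> complex mat"
    and \<gamma> \<sigma> \<eta> M0 :: real
    and \<beta> :: complex
  assumes "\<And>K. K \<ge> 3 \<Longrightarrow> prob_space (P K)"
    and "\<And>K. K \<ge> 3 \<Longrightarrow> N K \<ge> 3"
    and "1 < \<gamma>" and "(\<lambda>K. real (N K) / real K) \<longlonglongrightarrow> \<gamma>"
    and "finite S" and "S \<noteq> {}" and "0 \<notin> S"
    and "0 \<le> \<sigma>" and "0 < \<eta>" and "\<beta> \<noteq> 0"
    and "admissible_f f" and "admissible_q q X M0"
    and "nearest_point_map S dec" and "householder R"
    and "\<And>K. K \<ge> 3 \<Longrightarrow> iid (P K) (CN (1 / real (N K))) (H K) ({..<K} \<times> {..<N K})"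
    and "\<And>K \<omega>. K \<ge> 3 \<Longrightarrow> \<omega> \<in> space (P K) \<Longrightarrow>
           singular_values (mat K (N K) (\<lambda>ij. H K ij \<omega>)) (\<lambda>i. d K i \<omega>)"
    and "\<And>K. K \<ge> 3 \<Longrightarrow> iid (P K) (uniform_on S) (s K) {..<K}"
    and "\<And>K. K \<ge> 3 \<Longrightarrow> iid (P K) (CN (\<sigma>\<^sup>2)) (n K) {..<K}"
    and "\<And>K. K \<ge> 3 \<Longrightarrow> iid (P K) (CN 1) (g1 K) {..<K}"
    and "\<And>K. K \<ge> 3 \<Longrightarrow> iid (P K) (CN 1) (g2 K) {..<K}"
    and "\<And>K. K \<ge> 3 \<Longrightarrow> iid (P K) (CN 1) (z1 K) {..<N K}"
    and "\<And>K. K \<ge> 3 \<Longrightarrow> iid (P K) (CN 1) (z2 K) {..<N K}"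
    and "\<And>K. K \<ge> 3 \<Longrightarrow> indep_vectors (P K)
           [(K, \<lambda>i \<omega>. complex_of_real (d K i \<omega>)), (K, s K), (K, n K),
            (K, g1 K), (K, g2 K), (N K, z1 K), (N K, z2 K)]"
    (* the denominator in the constants L does not vanish; automatic when the noise variance is positive *)
    and "eff_var \<beta> \<eta> \<sigma> (T_g_bar \<gamma> S f q) \<noteq> 0"
  shows "\<exists>Kbar>0. \<forall>K>Kbar. \<forall>k<K.
    (let D = (\<lambda>\<omega>. rect_diag K (N K) (\<lambda>i. d K i \<omega>));
         fD = (\<lambda>\<omega>. rect_diag K (N K) (\<lambda>i. f (d K i \<omega>)));
         sv = (\<lambda>\<omega>. vec K (\<lambda>i. s K i \<omega>));
         g1v = (\<lambda>\<omega>. vec K (\<lambda>i. g1 K i \<omega>));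
         g2v = (\<lambda>\<omega>. vec K (\<lambda>i. g2 K i \<omega>));
         z1v = (\<lambda>\<omega>. vec (N K) (\<lambda>i. z1 K i \<omega>));
         z2v = (\<lambda>\<omega>. vec (N K) (\<lambda>i. z2 K i \<omega>));
         Ts = (\<lambda>\<omega>. T_s R q (D \<omega>) (fD \<omega>) (sv \<omega>) (g1v \<omega>) (g2v \<omega>) (z1v \<omega>) (z2v \<omega>));
         Tg = (\<lambda>\<omega>. complex_of_real
                (T_g R q (D \<omega>) (fD \<omega>) (sv \<omega>) (g1v \<omega>) (g2v \<omega>) (z1v \<omega>) (z2v \<omega>)));
         Ts' = T_s_bar \<gamma> S f q;
         Tg' = complex_of_real (T_g_bar \<gamma> S f q);
         y_hat = (\<lambda>\<omega>. \<eta> * Ts \<omega> * s K k \<omega> + \<eta> * Tg \<omega> * g2 K k \<omega> + n K k \<omega>);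
         y_bar = (\<lambda>\<omega>. \<eta> * Ts' * s K k \<omega> + \<eta> * Tg' * g2 K k \<omega> + n K k \<omega>)
     in \<bar>SEP (P K) dec \<beta> y_hat (s K k) - SEP (P K) dec \<beta> y_bar (s K k)\<bar>
        \<le> 1 / real (card S) *
           (\<Sum>z\<in>S. L_const \<beta> \<eta> \<sigma> (T_g_bar \<gamma> S f q) z *
              (dKF (P K) Ts (\<lambda>_. Ts')
               + dKF (P K) (\<lambda>\<omega>. Tg \<omega> * g2 K k \<omega>) (\<lambda>\<omega>. Tg' * g2 K k \<omega>))))"
  unfolding Let_def
\<comment> \<open>The estimate is non-asymptotic; the threshold 3 places \<open>K\<close> in the
  range of the hypotheses.\<close>
proof (intro exI[of _ "3 :: nat"] conjI allI impI)
  fix K k :: nat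
  assume "3 < K" "k < K"
  then have K: "3 \<le> K"
    by simp
  note P = assms(1)[OF K]
  note ind = assms(23)[OF K]
  interpret prob_space "P K"
    by (rule P)
  note iid = assms(17-22)[OF K, unfolded iid_def]
  have law: "distr (P K) borel (s K k) = uniform_on S" "distr (P K) borel (g2 K k) = CN 1"
    "distr (P K) borel (n K k) = CN (\<sigma>\<^sup>2)"
    using iid \<open>k < K\<close> by auto
  have rv: "X K i \<in> borel_measurable (P K)"
    if "X = s \<and> i < K \<or> X = g1 \<and> i < K \<or> X = g2 \<and> i < K \<or> X = z1 \<and> i < N K \<or> X = z2 \<and> i < N K" for X i
    using iid that by (auto simp: indep_vars_def)
  \<comment> \<open>The members of an independent family are random variables; \<open>d\<close> is
    recovered from its complex embedding by \<open>Re\<close>.\<close>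
  have d: "d K i \<in> borel_measurable (P K)" if "i < K" for i
  proof -
    let ?Xs = "[(K, \<lambda>i \<omega>. complex_of_real (d K i \<omega>)), (K, s K), (K, n K),
      (K, g1 K), (K, g2 K), (N K, z1 K), (N K, z2 K)]"
    have "indep_var borel (snd (?Xs ! 0) i) borel (snd (?Xs ! 1) i)"
      using that by (intro indep_vectors_entries(2)[OF P ind, of 2 0 1 i]) auto
    from indep_var_rv1[OF this] show ?thesis
      using measurable_compose[of "\<lambda>\<omega>. complex_of_real (d K i \<omega>)" "P K" borel Re borel] by simp
  qed
  have f: "(\<lambda>\<omega>. f (d K i \<omega>)) \<in> borel_measurable (P K)" if "i < K" for i
    using assms(11) d[OF that] by (auto simp: admissible_f_def intro: measurable_compose)
  have q: "q \<in> borel_measurable borel"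
    using assms(12) by (simp add: admissible_q_def)
  let ?t = "T_g_bar \<gamma> S f q"
  \<comment> \<open>\<open>eff_var\<close> is the square of \<open>cmod \<beta>\<close> times this
    sum of squares, so it would vanish if both squares did.\<close>
  have pos: "0 < (\<eta> * ?t)\<^sup>2 + \<sigma>\<^sup>2"
    using assms(24) by (auto simp: eff_var_def sum_power2_gt_zero_iff)
  \<comment> \<open>Positions 1, 4 and 2 in the list of independent vectors are \<open>s\<close>,
    \<open>g2\<close> and \<open>n\<close>.\<close>
  have gn: "indep_var borel (g2 K k) borel (n K k)"
    using indep_vectors_entries(2)[OF P ind, of 1 4 2 k k k] \<open>k < K\<close> by simp
  have sgn: "indep_var borel (s K k) borel (\<lambda>\<omega>. of_real (\<eta> * ?t) * g2 K k \<omega> + n K k \<omega>)"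
    using indep_vectors_entries(1)[OF P ind, of 1 4 2 k k k "\<lambda>p. of_real (\<eta> * ?t) * fst p + snd p"] \<open>k < K\<close>
    by simp
  let ?D = "\<lambda>\<omega>. rect_diag K (N K) (\<lambda>i. d K i \<omega>)" and ?fD = "\<lambda>\<omega>. rect_diag K (N K) (\<lambda>i. f (d K i \<omega>))"
    and ?s = "\<lambda>\<omega>. vec K (\<lambda>i. s K i \<omega>)"
    and ?g1 = "\<lambda>\<omega>. vec K (\<lambda>i. g1 K i \<omega>)" and ?g2 = "\<lambda>\<omega>. vec K (\<lambda>i. g2 K i \<omega>)"
    and ?z1 = "\<lambda>\<omega>. vec (N K) (\<lambda>i. z1 K i \<omega>)" and ?z2 = "\<lambda>\<omega>. vec (N K) (\<lambda>i. z2 K i \<omega>)"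
  let ?Ts = "\<lambda>\<omega>. T_s R q (?D \<omega>) (?fD \<omega>) (?s \<omega>) (?g1 \<omega>) (?g2 \<omega>) (?z1 \<omega>) (?z2 \<omega>)"
  let ?Tg = "\<lambda>\<omega>. complex_of_real (T_g R q (?D \<omega>) (?fD \<omega>) (?s \<omega>) (?g1 \<omega>) (?g2 \<omega>) (?z1 \<omega>) (?z2 \<omega>))"
  have "?Ts \<in> borel_measurable (P K)" "?Tg \<in> borel_measurable (P K)"
    using K rv d f
    by (intro borel_measurable_T_s[where K = K and N = "N K"] borel_measurable_complex_of_real
        borel_measurable_T_g[where K = K and N = "N K"] measurable_mat_rect_diag measurable_vec_vec
        \<open>householder R\<close> q; simp)+
  from SEP_diff_dKF[OF P \<open>finite S\<close> \<open>S \<noteq> {}\<close> \<open>nearest_point_map S dec\<close> \<open>\<beta> \<noteq> 0\<close> \<open>0 < \<eta>\<close> pos sgn gn law this]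
  show "\<bar>SEP (P K) dec \<beta> (\<lambda>\<omega>. \<eta> * ?Ts \<omega> * s K k \<omega> + \<eta> * ?Tg \<omega> * g2 K k \<omega> + n K k \<omega>) (s K k)
      - SEP (P K) dec \<beta> (\<lambda>\<omega>. \<eta> * T_s_bar \<gamma> S f q * s K k \<omega> + \<eta> * complex_of_real ?t * g2 K k \<omega> + n K k \<omega>) (s K k)\<bar>
    \<le> 1 / real (card S) * (\<Sum>z\<in>S. L_const \<beta> \<eta> \<sigma> ?t z *
        (dKF (P K) ?Ts (\<lambda>_. T_s_bar \<gamma> S f q)
         + dKF (P K) (\<lambda>\<omega>. ?Tg \<omega> * g2 K k \<omega>) (\<lambda>\<omega>. complex_of_real ?t * g2 K k \<omega>)))" .
qed simp

end
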